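(* Let $B$ be a non-collinear bar of $T(f,g)$, and let $c\in C(B)$ with cover $\{\bar B_1,\dots,\bar B_l\}$. Then there are exactly $$m_B(c)+\sum_{s=1}^l[n(\bar B_s)-m(\bar B_s)]$$ polar roots (counted with multiplicity) which climb over $B$ at $c$ and are bounded by every $\bar B_s$, $1\le s\le l$.
   Context: SETTING. Let $f,g:(\mathbb C^2,O)\to(\mathbb C,O)$ be holomorphic germs in coordinates $(x,y)$, with Newton–Puiseux factorisations $f=u\,y^{E_1}\prod_{i=1}^p[x-\alpha_i(y)]$, $g=u'\,y^{E_2}\prod_{j=1}^q[x-\beta_j(y)]$, where $E_1,E_2\ge 0$, $u,u'$ are units and $\alpha_i,\beta_j$ are fractional power series in $y$ of positive order $O_y$. Write $\lambda_1,\dots,\lambda_N$ ($N=p+q\ge1$) for $\alpha_1,\dots,\alpha_p,\beta_1,\dots,\beta_q$; they are assumed pairwise distinct. Put $O(\lambda,\mu):=O_y(\lambda(y)-\mu(y))$ (contact order). An arc is a fractional power series in $y$. Let $J=f_yg_x-f_xg_y$. A polar root is a Newton–Puiseux root $x=\gamma(y)$ of $J$ with $O_y(\gamma)>0$ and $f(\gamma(y),y)g(\gamma(y),y)\ne0$; polar roots are counted with multiplicity. TREE $T(f,g)$. The ground bar $B_*$ has height $h(B_* )=0$ and carries one trunk (the main trunk), consisting of all $\lambda_k$. On top of each trunk there is one bar $B$ whose height $h(B)$ is the minimum of the contact orders between members of the trunk ($\infty$ if the trunk has one member); the members of the trunk are divided into classes by $\lambda\equiv\mu$ iff $O(\lambda,\mu)>h(B)$,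 and each class is a trunk growing on $B$; continue recursively. Bars of infinite height are omitted: "bar" means bar of finite height. A trunk consisting of $s$ of the $\alpha_i$ and $t$ of the $\beta_j$ has bimultiplicity $[s,t]$. For a bar $B$ and a root $\lambda_k$ in a trunk on $B$, let $\lambda_B$ be $\lambda_k$ with all terms $y^e$, $e\ge h(B)$, omitted (independent of the choice of $\lambda_k$; $\lambda_{B_*}=0$). Then $\lambda_k=\lambda_B+cy^{h(B)}+\cdots$, and the trunk containing $\lambda_k$ is said to grow on $B$ at $c\in\mathbb C$ (the main trunk grows on $B_*$ at $0$). If $B'$ is the bar on top of a trunk growing on $B$ at $c$, then $B'$ is a postbar of $B$ supported at $c$, written $B\perp_cB'$ or $B\perp B'$. If $B\perp_c B_1\perp\cdots\perp B'$ (or $B\perp_cB'$), then $B'$ lies over $c$. An arc $\xi$ climbs over $B$ at $a\in\mathbb C$ if $\xi=\lambda_B+ay^{h(B)}+\cdots$ ($\cdots$ meaning higher order terms); $\xi$ is bounded by $B$ if $O(\xi,\lambda_B)<h(B)$. RATIONAL FUNCTION. For a bar $B$ and $F\in\{f,g\}$ let $\nu_F(B):=O_y(F(\lambda_B(y)+zy^{h(B)},y))$ for generic $z$ (so $\nu_f(B_* )=E_1$, $\nu_g(B_* )=E_2$). Let the trunks on $B$ grow at $z_1,\dots,z_l$ with bimultiplicities $[p_k,q_k]$. Put $\Delta_B(z_k):=\nu_f(B)q_k-\nu_g(B)p_k$ and $\mathcal M_B(z):=\sum_{k}\frac{\Delta_B(z_k)}{z-z_k}$. The point $z_k$ is collinear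 if $\Delta_B(z_k)=0$ and non-collinear otherwise; $C(B)$, $N(B)$ are the sets of collinear and non-collinear points among the $z_k$, and $n(B)$ is the cardinality of $N(B)$. $B$ is collinear if $N(B)=\emptyset$, non-collinear otherwise. For non-collinear $B$, $m_B(z)$ is the multiplicity of $z\in\mathbb C$ as a zero of $\mathcal M_B$ ($m_B(z)=0$ if $z$ is not a zero), and $m(B)=\sum_z m_B(z)$. COVER. For $c\in C(B)$, a set of non-collinear bars $\{\bar B_1,\dots,\bar B_l\}$ is a cover of $c$ if: (i) each $\bar B_s$ lies over $c$ and there is a sequence $B\perp B_1^*\perp\cdots\perp B^*_{r(s)}\perp\bar B_s$ with $B\perp_cB_1^*$, where either $r(s)=0$ (i.e. $B\perp_c\bar B_s$) or all $B_i^*$, $1\le i\le r(s)$, are collinear; (ii) each root $\lambda_k$ climbing over $B$ at $c$ also climbs over a unique $\bar B_s$. Every $c\in C(B)$ has a unique cover. *)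

theory Defs
  imports "HOL-Complex_Analysis.Complex_Analysis"
    "HOL-Computational_Algebra.Formal_Power_Series"
begin

(* A power series F in two variables is read as a power series in x over C[[y]]: the
   outer index is the exponent of x, the inner one that of y.  Germs of holomorphic functions at
   the origin of C^2 are identified with their convergent Taylor series. *)

type_synonym series2 = "complex fps fps"

definition coeff2 :: "series2 \<Rightarrow> nat \<Rightarrow> nat \<Rightarrow> complex" where
  "coeff2 F i j = fps_nth (fps_nth F i) j"

definition holomorphic_germ :: "series2 \<Rightarrow> bool" where
  "holomorphic_germ F \<longleftrightarrow>
     (\<exists>r>0. (\<lambda>(i, j). norm (coeff2 F i j) * r ^ (i + j)) summable_on UNIV)"

definition unit_germ :: "series2 \<Rightarrow> bool" where
  "unit_germ u \<longleftrightarrow> holomorphic_germ u \<and> coeff2 u 0 0 \<noteq> 0"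

definition deriv_x :: "series2 \<Rightarrow> series2" where
  "deriv_x F = fps_deriv F"

definition deriv_y :: "series2 \<Rightarrow> series2" where
  "deriv_y F = Abs_fps (\<lambda>i. fps_deriv (fps_nth F i))"

definition jacobian_det :: "series2 \<Rightarrow> series2 \<Rightarrow> series2" where
  "jacobian_det f g = deriv_y f * deriv_x g - deriv_x f * deriv_y g"


(* A fractional power series in y is represented by its coefficient function: a e is the
   coefficient of y^e.  Its exponents have to lie in (1/n)N for some n > 0. *)

type_synonym fracseries = "real \<Rightarrow> complex"

definition denominator :: "nat \<Rightarrow> fracseries \<Rightarrow> bool" where
  "denominator n a \<longleftrightarrow> n > 0 \<and> (\<forall>e. a e \<noteq> 0 \<longrightarrow> (\<exists>k::nat. e = real k / real n))"

definition is_arc :: "fracseries \<Rightarrow> bool" where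
  "is_arc a \<longleftrightarrow> (\<exists>n. denominator n a)"

(* The infimum of the empty set is \<infinity>, the order of the zero series. *)
definition ord_y :: "fracseries \<Rightarrow> ereal" where
  "ord_y a = (INF e\<in>{e. a e \<noteq> 0}. ereal e)"

definition contact :: "fracseries \<Rightarrow> fracseries \<Rightarrow> ereal" where
  "contact a b = ord_y (\<lambda>e. a e - b e)"

(* The substitution y = t^n, in a fractional power series with denominator n and in a series
   in x and y, and the way back from power series in t to fractional power series in y. *)

definition ramify :: "nat \<Rightarrow> fracseries \<Rightarrow> complex fps" where
  "ramify n a = Abs_fps (\<lambda>k. a (real k / real n))"

definition ramify2 :: "nat \<Rightarrow> series2 \<Rightarrow> series2" where
  "ramify2 n F = Abs_fps (\<lambda>i. fps_compose (fps_nth F i) (fps_X ^ n))"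

definition unramify :: "nat \<Rightarrow> complex fps \<Rightarrow> fracseries" where
  "unramify n S = (\<lambda>e. if e \<ge> 0 \<and> real n * e \<in> \<int> then fps_nth S (nat \<lfloor>real n * e\<rfloor>) else 0)"

definition least_denominator :: "fracseries \<Rightarrow> nat" where
  "least_denominator a = (LEAST n. denominator n a)"

(* F(a(y), y).  If a has positive order, only the terms with i \<le> k contribute to the coefficient
   of t^k; the infinite sum also covers a small nonzero constant term (needed for the ground
   bar only), where it converges for holomorphic F. *)
definition eval_arc :: "series2 \<Rightarrow> fracseries \<Rightarrow> fracseries" where
  "eval_arc F a =
     (let n = least_denominator a
      in unramify n (Abs_fps (\<lambda>k. \<Sum>i. fps_nth (fps_nth (ramify2 n F) i * ramify n a ^ i) k)))"

(* F = u y^E prod (x - a(y)), as an identity of series in x and t, where y = t^n and n is a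
   common denominator of the roots a. *)
definition newton_puiseux ::
  "series2 \<Rightarrow> series2 \<Rightarrow> nat \<Rightarrow> fracseries list \<Rightarrow> bool" where
  "newton_puiseux F u E rs \<longleftrightarrow>
     unit_germ u \<and> (\<forall>a\<in>set rs. is_arc a \<and> ord_y a > 0) \<and>
     (\<exists>n>0. (\<forall>a\<in>set rs. denominator n a) \<and>
        ramify2 n F =
          ramify2 n u * fps_const (fps_X ^ (n * E)) *
          (\<Prod>a\<leftarrow>rs. fps_X - fps_const (ramify n a)))"

(* The largest m such that (x - a(y))^m divides F. *)
definition root_mult :: "series2 \<Rightarrow> fracseries \<Rightarrow> nat" where
  "root_mult F a =
     (let n = least_denominator a
      in Max {m. (fps_X - fps_const (ramify n a)) ^ m dvd ramify2 n F})"

definition polar_root :: "series2 \<Rightarrow> series2 \<Rightarrow> fracseries \<Rightarrow> bool" where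
  "polar_root f g \<gamma> \<longleftrightarrow>
     is_arc \<gamma> \<and> ord_y \<gamma> > 0 \<and> eval_arc (jacobian_det f g) \<gamma> = (\<lambda>_. 0) \<and>
     eval_arc f \<gamma> \<noteq> (\<lambda>_. 0) \<and> eval_arc g \<gamma> \<noteq> (\<lambda>_. 0)"


(* The tree.  Trunks are sets of roots.  A bar (of finite height) is the pair of the set of all
   roots in the trunks growing on it and its height; for the bar on top of a trunk this set is
   the trunk.  As all roots have positive order, the classes of the ground bar (R, 0) reduce to
   the single class R, growing at 0, so that the ground bar needs no special treatment. *)

type_synonym bar = "fracseries set \<times> real"

definition height :: "bar \<Rightarrow> real" where
  "height B = snd B"

definition trunk_height :: "fracseries set \<Rightarrow> ereal" where
  "trunk_height T = (INF a\<in>T. INF b\<in>T. contact a b)"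

definition trunks_on :: "bar \<Rightarrow> fracseries set set" where
  "trunks_on B = (\<lambda>a. {b \<in> fst B. contact a b > ereal (height B)}) ` fst B"

inductive_set bars :: "fracseries set \<Rightarrow> bar set" for R where
  ground: "(R, 0) \<in> bars R"
| top: "B \<in> bars R \<Longrightarrow> T \<in> trunks_on B \<Longrightarrow> trunk_height T \<noteq> \<infinity> \<Longrightarrow>
    (T, real_of_ereal (trunk_height T)) \<in> bars R"

(* The common part of the roots on B; it does not depend on the chosen root. *)
definition bar_arc :: "bar \<Rightarrow> fracseries" where
  "bar_arc B = (\<lambda>e. if e < height B then (SOME a. a \<in> fst B) e else 0)"

(* bar_arc B + z y^(height B) *)
definition bar_arc_plus :: "bar \<Rightarrow> complex \<Rightarrow> fracseries" where
  "bar_arc_plus B z = (\<lambda>e. bar_arc B e + (if e = height B then z else 0))"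

definition climbs :: "fracseries \<Rightarrow> bar \<Rightarrow> complex \<Rightarrow> bool" where
  "climbs \<xi> B a \<longleftrightarrow> contact \<xi> (bar_arc_plus B a) > ereal (height B)"

definition bounded_by :: "fracseries \<Rightarrow> bar \<Rightarrow> bool" where
  "bounded_by \<xi> B \<longleftrightarrow> contact \<xi> (bar_arc B) < ereal (height B)"

definition growth_point :: "bar \<Rightarrow> fracseries set \<Rightarrow> complex" where
  "growth_point B T = (THE c. \<forall>\<xi>\<in>T. climbs \<xi> B c)"

definition postbar_at :: "bar \<Rightarrow> complex \<Rightarrow> bar \<Rightarrow> bool" where
  "postbar_at B c B' \<longleftrightarrow>
     (\<exists>T\<in>trunks_on B. growth_point B T = c \<and> trunk_height T \<noteq> \<infinity> \<and>
        B' = (T, real_of_ereal (trunk_height T)))"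

definition postbar :: "bar \<Rightarrow> bar \<Rightarrow> bool" where
  "postbar B B' \<longleftrightarrow> (\<exists>c. postbar_at B c B')"

definition lies_over :: "bar \<Rightarrow> complex \<Rightarrow> bar \<Rightarrow> bool" where
  "lies_over B c B' \<longleftrightarrow> (\<exists>B1. postbar_at B c B1 \<and> postbar\<^sup>*\<^sup>* B1 B')"


(* Generic z: all but finitely many z.  On the ground bar, F(z, y) only makes sense for
   small z, and there generic z are the small nonzero z. *)
definition generic :: "bar \<Rightarrow> (complex \<Rightarrow> bool) \<Rightarrow> bool" where
  "generic B P \<longleftrightarrow>
     (if height B > 0 then finite {z. \<not> P z} else (\<forall>\<^sub>F z in at 0. P z))"

definition nu :: "series2 \<Rightarrow> bar \<Rightarrow> real" where
  "nu F B = (THE v. generic B (\<lambda>z. ord_y (eval_arc F (bar_arc_plus B z)) = ereal v))"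

(* In the following, P and Q are the sets of roots of f and of g, respectively, so that a trunk T
   has bimultiplicity [card (T \<inter> P), card (T \<inter> Q)]. *)

definition Delta :: "series2 \<Rightarrow> series2 \<Rightarrow> fracseries set \<Rightarrow> fracseries set \<Rightarrow>
    bar \<Rightarrow> fracseries set \<Rightarrow> real" where
  "Delta f g P Q B T = nu f B * real (card (T \<inter> Q)) - nu g B * real (card (T \<inter> P))"

definition rational_fun :: "series2 \<Rightarrow> series2 \<Rightarrow> fracseries set \<Rightarrow> fracseries set \<Rightarrow>
    bar \<Rightarrow> complex \<Rightarrow> complex" where
  "rational_fun f g P Q B z =
     (\<Sum>T\<in>trunks_on B. complex_of_real (Delta f g P Q B T) / (z - growth_point B T))"

definition collinear_points :: "series2 \<Rightarrow> series2 \<Rightarrow> fracseries set \<Rightarrow> fracseries set \<Rightarrow>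
    bar \<Rightarrow> complex set" where
  "collinear_points f g P Q B = growth_point B ` {T \<in> trunks_on B. Delta f g P Q B T = 0}"

definition noncollinear_points :: "series2 \<Rightarrow> series2 \<Rightarrow> fracseries set \<Rightarrow> fracseries set \<Rightarrow>
    bar \<Rightarrow> complex set" where
  "noncollinear_points f g P Q B = growth_point B ` {T \<in> trunks_on B. Delta f g P Q B T \<noteq> 0}"

definition collinear_bar :: "series2 \<Rightarrow> series2 \<Rightarrow> fracseries set \<Rightarrow> fracseries set \<Rightarrow>
    bar \<Rightarrow> bool" where
  "collinear_bar f g P Q B \<longleftrightarrow> noncollinear_points f g P Q B = {}"

(* zorder is negative at poles, where nat turns it into 0. *)
definition zero_mult :: "series2 \<Rightarrow> series2 \<Rightarrow> fracseries set \<Rightarrow> fracseries set \<Rightarrow>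
    bar \<Rightarrow> complex \<Rightarrow> nat" where
  "zero_mult f g P Q B z = nat (zorder (rational_fun f g P Q B) z)"

definition total_zero_mult :: "series2 \<Rightarrow> series2 \<Rightarrow> fracseries set \<Rightarrow> fracseries set \<Rightarrow>
    bar \<Rightarrow> nat" where
  "total_zero_mult f g P Q B =
     (\<Sum>z\<in>{z. zero_mult f g P Q B z \<noteq> 0}. zero_mult f g P Q B z)"

(* Either B' is a postbar of B at c, or there is a sequence B, B1, ..., Br, B' of successive
   postbars, the first one at c, with r \<ge> 1 and B1, ..., Br collinear. *)
definition collinear_chain :: "series2 \<Rightarrow> series2 \<Rightarrow> fracseries set \<Rightarrow> fracseries set \<Rightarrow>
    bar \<Rightarrow> complex \<Rightarrow> bar \<Rightarrow> bool" where
  "collinear_chain f g P Q B c B' \<longleftrightarrow>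
     postbar_at B c B' \<or>
     (\<exists>B1 Br. postbar_at B c B1 \<and> collinear_bar f g P Q B1 \<and>
        (\<lambda>X Y. postbar X Y \<and> collinear_bar f g P Q Y)\<^sup>*\<^sup>* B1 Br \<and> postbar Br B')"

definition is_cover :: "series2 \<Rightarrow> series2 \<Rightarrow> fracseries set \<Rightarrow> fracseries set \<Rightarrow>
    bar \<Rightarrow> complex \<Rightarrow> bar set \<Rightarrow> bool" where
  "is_cover f g P Q B c S \<longleftrightarrow>
     (\<forall>B'\<in>S. B' \<in> bars (P \<union> Q) \<and> \<not> collinear_bar f g P Q B' \<and>
        lies_over B c B' \<and> collinear_chain f g P Q B c B') \<and>
     (\<forall>\<xi>\<in>P \<union> Q. climbs \<xi> B c \<longrightarrow> (\<exists>!B'. B' \<in> S \<and> (\<exists>a. climbs \<xi> B' a)))"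

end

theory Submission
  imports Defs "HOL-Computational_Algebra.Fundamental_Theorem_Algebra"
begin

text \<open>
The proof counts polar roots in discs of arcs. For a bar \<open>B\<close> of height \<open>h > 0\<close> with common
arc \<open>\<lambda>\<close>, let \<open>disc_of B\<close> be the set of all arcs that agree with \<open>\<lambda>\<close> below the exponent \<open>h\<close>, that
is, the arcs not bounded by \<open>B\<close>. The substitution \<open>x = \<lambda>(y) + z y\<^sup>h\<close>, \<open>y = t\<^sup>N\<close>, where \<open>N\<close> is a
common denominator of the roots of \<open>f\<close>, \<open>g\<close> and \<open>J\<close>, turns \<open>f\<close>, \<open>g\<close> and \<open>J = f\<^sub>y g\<^sub>x - f\<^sub>x g\<^sub>y\<close> into series in
\<open>t\<close> whose coefficients are polynomials in \<open>z\<close>. If a series is a product of linear factors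
\<open>x - a(y)\<close>, a power of \<open>y\<close> and a unit, then its lowest coefficient is, up to a constant, the
product of the \<open>z - c\<close> where \<open>c\<close> is the coefficient of \<open>y\<^sup>h\<close> in \<open>a\<close>, over the roots \<open>a\<close> in the disc:
a root outside the disc contributes a constant. So the degree of the lowest coefficient is the number
of roots in the disc, and its order at \<open>c\<close> is the number of those climbing over \<open>B\<close> at \<open>c\<close>
(\<open>lead_disc\<close>).

Let \<open>F\<close> and \<open>G\<close> be the lowest coefficients of \<open>f\<close> and \<open>g\<close>, in degrees proportional to \<open>\<mu> = \<nu>\<^sub>f(B)\<close> and
\<open>\<kappa> = \<nu>\<^sub>g(B)\<close>. By the chain rule the lowest coefficient of \<open>J\<close> is \<open>K = \<mu> F G' - \<kappa> F' G\<close>, unless this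
vanishes (\<open>lead_disc_jacobian\<close>), and \<open>K = F G M\<close> where \<open>M\<close> is the rational function of the bar. At a
non-collinear point \<open>M\<close> has a simple pole, at a collinear one it has none. For a non-collinear bar
\<open>K\<close> is therefore nonzero, and comparing degrees and orders of \<open>K\<close> and \<open>F G\<close> gives
(\<open>polar_roots_on_bar\<close>):
\<^item> the number of roots of \<open>J\<close> in the disc of \<open>B\<close> is the number of roots of \<open>f g\<close> in it, minus
  \<open>n(B)\<close>, plus \<open>m(B)\<close>;
\<^item> the number of roots of \<open>J\<close> climbing over \<open>B\<close> at a collinear point \<open>c\<close> is the number of roots of
  \<open>f g\<close> doing so, plus \<open>m\<^sub>B(c)\<close>.

The discs of the bars of a cover of \<open>c\<close> are pairwise disjoint, all of their arcs climb over \<open>B\<close> at \<open>c\<close>,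
and every root of \<open>f g\<close> that climbs over \<open>B\<close> at \<open>c\<close> lies in one of them. Subtracting the counts for
the bars of the cover from the count for \<open>B\<close> at \<open>c\<close>, the roots of \<open>f g\<close> cancel and the claimed
number remains. As the \<open>\<alpha>\<^sub>i\<close> and \<open>\<beta>\<^sub>j\<close> are distinct, \<open>J\<close> vanishes on none of them
(\<open>jacobian_nonzero_at_root\<close>), so its roots of positive order are exactly the polar roots.

All this presupposes that \<open>J\<close> has a factorisation into linear factors with fractional power series
as roots; this is the Newton-Puiseux theorem for formal power series in two variables, which is
proved first.
\<close>

section \<open>Substitution of a power series for the outer variable\<close>

text \<open>The value \<open>F(a(t), t)\<close> of a series in \<open>x\<close> over a ring of power series in \<open>t\<close>. When \<open>a\<close> has no constant
term, the terms \<open>F\<^sub>i a\<^sup>i\<close> with \<open>i > k\<close> do not reach the coefficient of \<open>t\<^sup>k\<close>, so that the infinite sum is finite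
in each coefficient.\<close>
definition eval_x :: "'a::comm_ring_1 fps \<Rightarrow> 'a fps fps \<Rightarrow> 'a fps" where
  "eval_x a F = Abs_fps (\<lambda>k. \<Sum>i\<le>k. fps_nth (fps_nth F i * a ^ i) k)"

lemma fps_power_nth_below:
  fixes a :: "'a::comm_ring_1 fps"
  assumes "fps_nth a 0 = 0" and "k < i"
  shows "fps_nth (b * a ^ i) k = 0"
proof -
  have "fps_nth (a ^ i) j = 0" if "j \<le> k" for j
    using startsby_zero_power_prefix[OF assms(1)] assms(2) that by simp
  then show ?thesis
    by (simp add: fps_mult_nth)
qed

lemma eval_x_nth:
  assumes "fps_nth a 0 = 0" and "k \<le> N"
  shows "fps_nth (eval_x a F) k = (\<Sum>i\<le>N. fps_nth (fps_nth F i * a ^ i) k)"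
  unfolding eval_x_def fps_nth_Abs_fps
  by (rule sum.mono_neutral_left) (use assms in \<open>auto intro: fps_power_nth_below\<close>)

lemma eval_x_unfold:
  assumes "fps_nth a 0 = 0"
  shows "eval_x a F = fps_nth F 0 + a * eval_x a (fps_shift (Suc 0) F)"
proof (rule fps_ext)
  fix k
  have "fps_nth (a * eval_x a (fps_shift (Suc 0) F)) k =
      (\<Sum>j=0..k. fps_nth a j * (\<Sum>i\<le>k. fps_nth (fps_nth F (Suc i) * a ^ i) (k - j)))"
    unfolding fps_mult_nth[of a] using eval_x_nth[OF assms, of "k - _" k "fps_shift (Suc 0) F"] by simp
  also have "\<dots> = (\<Sum>i\<le>k. fps_nth (a * (fps_nth F (Suc i) * a ^ i)) k)"
    unfolding fps_mult_nth[of a] sum_distrib_left by (rule sum.swap)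
  also have "\<dots> = (\<Sum>i\<le>k. fps_nth (fps_nth F (Suc i) * a ^ Suc i) k)"
    by (simp add: mult_ac)
  finally have "fps_nth (fps_nth F 0 + a * eval_x a (fps_shift (Suc 0) F)) k =
      (\<Sum>i\<le>Suc k. fps_nth (fps_nth F i * a ^ i) k)"
    by (simp add: sum.atMost_Suc_shift del: sum.atMost_Suc)
  then show "fps_nth (eval_x a F) k = fps_nth (fps_nth F 0 + a * eval_x a (fps_shift (Suc 0) F)) k"
    using eval_x_nth[OF assms, of k "Suc k" F] by simp
qed

text \<open>The workhorse for identities between substitutions. Writing \<open>F = F\<^sub>0 + x F'\<close>, an identity that is
additive and holds for constants has an error \<open>e\<close> with \<open>e(F) = a \<cdot> e(F')\<close>; repeating this shows that
\<open>e(F)\<close> is divisible by every power of \<open>t\<close>. No limits or double sums are needed.\<close>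
lemma contraction_zero:
  fixes e :: "'b::zero fps \<Rightarrow> 'a::comm_ring_1 fps"
  assumes "fps_nth a 0 = 0" and step: "\<And>F. e F = a * e (fps_shift (Suc 0) F)"
  shows "e F = 0"
proof (rule fps_ext)
  fix k
  show "fps_nth (e F) k = fps_nth 0 k"
  proof (induction k arbitrary: F rule: less_induct)
    case (less k)
    have "fps_nth a j * fps_nth (e (fps_shift (Suc 0) F)) (k - j) = 0" if "j \<in> {0..k}" for j
      using assms(1) less[of "k - j" "fps_shift (Suc 0) F"] that by (cases "j = 0") auto
    then show ?case
      by (subst step) (simp add: fps_mult_nth)
  qed
qed

lemma fps_unfold: "(F::'a::comm_ring_1 fps) = fps_const (fps_nth F 0) + fps_X * fps_shift (Suc 0) F"
  by (rule fps_ext) (auto split: nat.split simp: fps_nth_fps_const)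

lemma fps_shift_unfold:
  fixes F :: "'a::comm_ring_1 fps"
  shows "fps_shift (Suc 0) (fps_const c * F) = fps_const c * fps_shift (Suc 0) F"
    "fps_shift (Suc 0) (fps_X * F) = F"
  by (auto intro!: fps_ext)

lemma eval_x_add: "eval_x a (F + G) = eval_x a F + eval_x a G"
  by (rule fps_ext) (simp add: eval_x_def algebra_simps sum.distrib)

lemma eval_x_const_mult:
  "eval_x a (fps_const c * F) = c * eval_x a F" if a0: "fps_nth a 0 = 0"
proof -
  have "eval_x a (fps_const c * F) - c * eval_x a F = 0"
  proof (rule contraction_zero[OF a0, of "\<lambda>F. eval_x a (fps_const c * F) - c * eval_x a F"])
    fix F
    show "eval_x a (fps_const c * F) - c * eval_x a F =
        a * (eval_x a (fps_const c * fps_shift (Suc 0) F) - c * eval_x a (fps_shift (Suc 0) F))"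
      by (subst (1 2) eval_x_unfold[OF a0], simp only: fps_shift_unfold) (simp add: algebra_simps)
  qed
  then show ?thesis by simp
qed

lemma eval_x_X_mult: "fps_nth a 0 = 0 \<Longrightarrow> eval_x a (fps_X * F) = a * eval_x a F"
  by (subst eval_x_unfold) (simp_all add: fps_shift_unfold)

lemma eval_x_const [simp]: "eval_x a (fps_const c) = c"
  by (rule fps_ext) (simp add: eval_x_def sum.delta' if_distrib[of "\<lambda>x. fps_nth (x * _) _"] cong: if_cong)

lemma eval_x_0 [simp]: "eval_x a 0 = 0" and eval_x_1 [simp]: "eval_x a 1 = 1"
  using eval_x_const[of a 0] eval_x_const[of a 1] by simp_all

lemma eval_x_X [simp]: "fps_nth a 0 = 0 \<Longrightarrow> eval_x a fps_X = a"
  using eval_x_X_mult[of a 1] by simp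

lemma eval_x_mult:
  assumes a0: "fps_nth a 0 = 0"
  shows "eval_x a (F * G) = eval_x a F * eval_x a G"
proof -
  have "eval_x a (F * G) - eval_x a F * eval_x a G = 0"
  proof (rule contraction_zero[OF a0, of "\<lambda>F. eval_x a (F * G) - eval_x a F * eval_x a G"])
    fix F
    have "F * G = fps_const (fps_nth F 0) * G + fps_X * (fps_shift (Suc 0) F * G)"
      by (subst fps_unfold[of F]) (simp add: algebra_simps)
    then have "eval_x a (F * G) = fps_nth F 0 * eval_x a G + a * eval_x a (fps_shift (Suc 0) F * G)"
      by (simp add: eval_x_add eval_x_const_mult[OF a0] eval_x_X_mult[OF a0])
    then show "eval_x a (F * G) - eval_x a F * eval_x a G =
        a * (eval_x a (fps_shift (Suc 0) F * G) - eval_x a (fps_shift (Suc 0) F) * eval_x a G)"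
      by (subst (2) eval_x_unfold[OF a0]) (simp add: algebra_simps)
  qed
  then show ?thesis by simp
qed

lemma eval_x_minus: "eval_x a (- F) = - eval_x a F"
  by (rule fps_ext) (simp add: eval_x_def sum_negf)

lemma eval_x_diff: "eval_x a (F - G) = eval_x a F - eval_x a G"
  by (rule fps_ext) (simp add: eval_x_def algebra_simps sum_subtractf)

lemma eval_x_prod_list:
  "fps_nth a 0 = 0 \<Longrightarrow> eval_x a (prod_list Fs) = prod_list (map (eval_x a) Fs)"
  by (induction Fs) (simp_all add: eval_x_mult)

lemma eval_x_nth_0: "fps_nth (eval_x a F) 0 = fps_nth (fps_nth F 0) 0"
  by (simp add: eval_x_def)

text \<open>Ring homomorphisms between power series rings commute with substitution. The case of interest is
the ramification \<open>t \<mapsto> t\<^sup>n\<close>, and the specialisation of a polynomial parameter.\<close>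
lemma eval_x_hom:
  fixes h :: "'a::comm_ring_1 fps \<Rightarrow> 'b::comm_ring_1 fps"
  assumes "fps_nth a 0 = 0" "fps_nth (h a) 0 = 0"
    and add: "\<And>x y. h (x + y) = h x + h y" and mult: "\<And>x y. h (x * y) = h x * h y"
  shows "h (eval_x a F) = eval_x (h a) (Abs_fps (\<lambda>i. h (fps_nth F i)))"
proof -
  let ?e = "\<lambda>F. h (eval_x a F) - eval_x (h a) (Abs_fps (\<lambda>i. h (fps_nth F i)))"
  have "?e F = 0"
  proof (rule contraction_zero[of "h a" ?e])
    show "?e F = h a * ?e (fps_shift (Suc 0) F)" for F
    proof -
      have "fps_shift (Suc 0) (Abs_fps (\<lambda>i. h (fps_nth F i))) = Abs_fps (\<lambda>i. h (fps_nth (fps_shift (Suc 0) F) i))"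
        by (rule fps_ext) simp
      then show ?thesis
        by (subst (1 2) eval_x_unfold) (simp_all add: assms algebra_simps)
    qed
  qed (fact assms)
  then show ?thesis by simp
qed

definition quot_x :: "'a::comm_ring_1 fps \<Rightarrow> 'a fps fps \<Rightarrow> 'a fps fps" where
  "quot_x a F = Abs_fps (\<lambda>i. eval_x a (fps_shift (Suc i) F))"

text \<open>The factor theorem in explicit form: the coefficients of the quotient by \<open>x - a\<close> are the values at
\<open>a\<close> of the tails of \<open>F\<close>, as in Horner's scheme.\<close>
lemma division_by_linear_factor:
  assumes a0: "fps_nth a 0 = 0"
  shows "F = fps_const (eval_x a F) + (fps_X - fps_const a) * quot_x a F"
proof (rule fps_ext)
  fix i
  have *: "eval_x a (fps_shift i F) = fps_nth F i + a * eval_x a (fps_shift (Suc i) F)"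
  proof -
    have "fps_shift (Suc 0) (fps_shift i F) = fps_shift (Suc i) F"
      by (simp add: fps_eq_iff)
    then show ?thesis
      by (subst eval_x_unfold[OF a0]) simp
  qed
  show "fps_nth F i = fps_nth (fps_const (eval_x a F) + (fps_X - fps_const a) * quot_x a F) i"
    using * by (cases i) (simp_all add: quot_x_def left_diff_distrib)
qed

lemma linear_factor_dvd_iff:
  assumes a0: "fps_nth a 0 = 0"
  shows "(fps_X - fps_const a) dvd F \<longleftrightarrow> eval_x a F = 0"
proof
  assume "eval_x a F = 0"
  then have "F = (fps_X - fps_const a) * quot_x a F"
    using division_by_linear_factor[OF a0, of F] by simp
  then show "(fps_X - fps_const a) dvd F"
    by (rule dvdI)
qed (auto simp: eval_x_mult[OF a0] eval_x_diff a0)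

text \<open>The divided derivative \<open>(1/j!) \<partial>\<^sub>x\<^sup>j F\<close>, whose value at \<open>s\<close> is the coefficient of \<open>x\<^sup>j\<close> in
\<open>F(s + x)\<close>.\<close>
definition hasse :: "nat \<Rightarrow> 'a::comm_ring_1 fps fps \<Rightarrow> 'a fps fps" where
  "hasse j F = Abs_fps (\<lambda>i. of_nat ((i + j) choose j) * fps_nth F (i + j))"

definition shift_x :: "'a::comm_ring_1 fps \<Rightarrow> 'a fps fps \<Rightarrow> 'a fps fps" where
  "shift_x s F = Abs_fps (\<lambda>j. eval_x s (hasse j F))"

lemma hasse_unfold:
  "hasse 0 F = F"
  "hasse (Suc j) F = hasse j (fps_shift (Suc 0) F) + fps_X * hasse (Suc j) (fps_shift (Suc 0) F)"
proof -
  show "hasse (Suc j) F = hasse j (fps_shift (Suc 0) F) + fps_X * hasse (Suc j) (fps_shift (Suc 0) F)"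
  proof (rule fps_ext)
    fix i show "fps_nth (hasse (Suc j) F) i =
        fps_nth (hasse j (fps_shift (Suc 0) F) + fps_X * hasse (Suc j) (fps_shift (Suc 0) F)) i"
      by (cases i) (simp_all add: hasse_def algebra_simps binomial_eq_0)
  qed
qed (simp add: hasse_def fps_eq_iff)

lemma shift_x_unfold:
  assumes s0: "fps_nth s 0 = 0"
  shows "shift_x s F = fps_const (fps_nth F 0) + (fps_X + fps_const s) * shift_x s (fps_shift (Suc 0) F)"
proof (rule fps_ext)
  fix j
  show "fps_nth (shift_x s F) j =
      fps_nth (fps_const (fps_nth F 0) + (fps_X + fps_const s) * shift_x s (fps_shift (Suc 0) F)) j"
  proof (cases j)
    case 0
    then show ?thesis
      using eval_x_unfold[OF s0, of F] by (simp add: shift_x_def hasse_unfold(1) distrib_right)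
  next
    case (Suc k)
    then show ?thesis
      by (simp add: shift_x_def hasse_unfold(2)[of k F] distrib_right eval_x_add eval_x_X_mult[OF s0])
  qed
qed

lemma eval_x_shift_x:
  assumes s0: "fps_nth s 0 = 0" and a0: "fps_nth a 0 = 0"
  shows "eval_x a (shift_x s F) = eval_x (s + a) F"
proof -
  let ?e = "\<lambda>F. eval_x a (shift_x s F) - eval_x (s + a) F"
  have "?e F = 0"
  proof (rule contraction_zero[of "s + a" ?e])
    show "?e F = (s + a) * ?e (fps_shift (Suc 0) F)" for F
      by (subst shift_x_unfold[OF s0], subst (2) eval_x_unfold)
         (simp_all add: s0 a0 eval_x_add eval_x_mult[OF a0] algebra_simps)
  qed (simp add: s0 a0)
  then show ?thesis by simp
qed

lemma shift_x_nth_0: "fps_nth (fps_nth (shift_x s F) j) 0 = fps_nth (fps_nth F j) 0"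
  by (simp add: shift_x_def eval_x_nth_0 hasse_def)

section \<open>Ramification\<close>

lemma ramify2_nth [simp]: "fps_nth (ramify2 n F) i = fps_nth F i oo fps_X ^ n"
  by (simp add: ramify2_def)

lemma ramify2_diff: "ramify2 n (F - G) = ramify2 n F - ramify2 n G"
  by (rule fps_ext) (simp add: fps_compose_sub_distrib)

lemma ramify2_mult: "n > 0 \<Longrightarrow> ramify2 n (F * G) = ramify2 n F * ramify2 n G"
  by (rule fps_ext) (simp add: fps_mult_nth fps_compose_sum_distrib fps_compose_mult_distrib)

lemma ramify2_const [simp]: "ramify2 n (fps_const c) = fps_const (c oo fps_X ^ n)"
  by (rule fps_ext) (simp add: fps_nth_fps_const)

lemma ramify2_1 [simp]: "ramify2 n 1 = 1"
  using ramify2_const[of n 1] by simp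

lemma ramify2_X [simp]: "ramify2 n fps_X = fps_X"
  by (rule fps_ext) (simp add: fps_X_def)

lemma ramify2_prod_list:
  "n > 0 \<Longrightarrow> ramify2 n (prod_list Fs) = prod_list (map (ramify2 n) Fs)"
  by (induction Fs) (simp_all add: ramify2_mult)

lemma compose_X_power_twice:
  fixes c :: "complex fps"
  assumes "m > 0" "n > 0"
  shows "(c oo fps_X ^ m) oo fps_X ^ n = c oo fps_X ^ (m * n)"
proof -
  have "c oo (fps_X ^ m oo fps_X ^ n) = c oo fps_X ^ m oo fps_X ^ n"
    by (rule fps_compose_assoc) (use assms in auto)
  then show ?thesis
    using assms by (simp add: fps_X_power_compose power_mult[symmetric] mult.commute)
qed

lemma ramify2_ramify2:
  "m > 0 \<Longrightarrow> n > 0 \<Longrightarrow> ramify2 n (ramify2 m F) = ramify2 (m * n) F"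
  by (rule fps_ext) (simp add: compose_X_power_twice)

lemma ramify2_one [simp]: "ramify2 (Suc 0) F = F"
  by (rule fps_ext) simp

lemma eval_x_ramify2:
  assumes "fps_nth a 0 = 0" and "n > 0"
  shows "eval_x a F oo fps_X ^ n = eval_x (a oo fps_X ^ n) (ramify2 n F)"
  using eval_x_hom[of a "\<lambda>c. c oo fps_X ^ n" F] assms
  by (simp add: fps_compose_add_distrib fps_compose_mult_distrib ramify2_def)

lemma ramify2_shift_x:
  assumes "fps_nth s 0 = 0" and "n > 0"
  shows "ramify2 n (shift_x s F) = shift_x (s oo fps_X ^ n) (ramify2 n F)"
proof -
  have of_nat: "of_nat m oo fps_X ^ n = (of_nat m :: complex fps)" for m
    by (metis fps_const_compose fps_of_nat)
  have "ramify2 n (hasse j F) = hasse j (ramify2 n F)" for j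
    by (rule fps_ext) (use assms in \<open>simp add: hasse_def fps_compose_mult_distrib of_nat\<close>)
  then show ?thesis
    by (intro fps_ext) (use assms in \<open>simp add: shift_x_def eval_x_ramify2\<close>)
qed

section \<open>The formal implicit function theorem\<close>

lemma fps_power_nth_cong:
  assumes "\<And>j. j \<le> k \<Longrightarrow> fps_nth a j = fps_nth b j"
  shows "j \<le> k \<Longrightarrow> fps_nth (a ^ i) j = fps_nth (b ^ i) j"
proof (induction i arbitrary: j)
  case (Suc i)
  then show ?case
    using assms by (auto simp: fps_mult_nth intro!: sum.cong)
qed simp

lemma eval_x_nth_cong:
  assumes "\<And>j. j \<le> k \<Longrightarrow> fps_nth a j = fps_nth b j"
  shows "fps_nth (eval_x a F) k = fps_nth (eval_x b F) k"
  unfolding eval_x_def fps_nth_Abs_fps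
  by (rule sum.cong[OF refl]) (auto simp: fps_mult_nth intro!: sum.cong arg_cong[where f = "\<lambda>z. _ * z"] fps_power_nth_cong[OF assms])

text \<open>Newton's iteration with the derivative frozen at the origin: by the factor theorem
\<open>F(y) = F(x) + (y - x) Q(y)\<close>, where \<open>Q(y)\<close> has the constant term \<open>c = F\<^sub>x(0, 0)\<close>, so that the step
\<open>y = x - F(x) / c\<close> multiplies the value of \<open>F\<close> by the series \<open>1 - Q(y) / c\<close> without constant term and
gains one order in \<open>t\<close>.\<close>
lemma formal_implicit_function:
  fixes F :: "complex fps fps"
  assumes F00: "fps_nth (fps_nth F 0) 0 = 0" and F10: "fps_nth (fps_nth F 1) 0 \<noteq> 0"
  shows "\<exists>x. fps_nth x 0 = 0 \<and> eval_x x F = 0"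
proof -
  define c where "c = fps_nth (fps_nth F 1) 0"
  define x where "x = rec_nat 0 (\<lambda>_ y. y - fps_const (1 / c) * eval_x y F)"
  have x_Suc: "x (Suc m) = x m - fps_const (1 / c) * eval_x (x m) F" and "x 0 = 0" for m
    by (simp_all add: x_def)
  have x0: "fps_nth (x m) 0 = 0" for m
    by (induction m) (simp_all add: x_Suc \<open>x 0 = 0\<close> eval_x_nth_0 F00)
  have small: "fps_nth (eval_x (x m) F) j = 0" if "j \<le> m" for m j
    using that
  proof (induction m arbitrary: j)
    case 0
    then show ?case by (simp add: eval_x_nth_0 F00)
  next
    case (Suc m)
    define y where "y = x (Suc m)"
    define q where "q = eval_x y (quot_x (x m) F)"
    have y0: "fps_nth y 0 = 0"
      by (simp add: y_def x0)
    have "eval_x y F = eval_x (x m) F + (y - x m) * q"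
      by (subst division_by_linear_factor[OF x0, of F m]) (simp add: eval_x_add eval_x_mult[OF y0] eval_x_diff y0 q_def)
    also have "y - x m = - (fps_const (1 / c) * eval_x (x m) F)"
      by (simp add: y_def x_Suc)
    finally have *: "eval_x y F = eval_x (x m) F * (1 - fps_const (1 / c) * q)"
      by (simp add: algebra_simps)
    have "fps_nth q 0 = c"
      by (simp add: q_def eval_x_nth_0 quot_x_def c_def)
    then have r0: "fps_nth (1 - fps_const (1 / c) * q) 0 = 0"
      using F10 by (simp add: c_def)
    have "fps_nth (eval_x (x m) F) i * fps_nth (1 - fps_const (1 / c) * q) (j - i) = 0"
      if "i \<in> {0..j}" for i
      using Suc.IH[of i] Suc.prems r0 that by (cases "i \<le> m") auto
    then show ?case
      unfolding y_def[symmetric] * fps_mult_nth by (rule sum.neutral[rule_format])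
  qed
  have stable: "fps_nth (x (m + k)) j = fps_nth (x m) j" if "j \<le> m" for m k j
    using that by (induction k) (simp_all add: x_Suc small)
  define a where "a = Abs_fps (\<lambda>k. fps_nth (x k) k)"
  have "fps_nth (eval_x a F) k = 0" for k
  proof -
    have "fps_nth (eval_x a F) k = fps_nth (eval_x (x k) F) k"
    proof (rule eval_x_nth_cong)
      show "fps_nth a j = fps_nth (x k) j" if "j \<le> k" for j
        using stable[of j j "k - j"] that by (simp add: a_def)
    qed
    then show ?thesis by (simp add: small)
  qed
  moreover have "fps_nth a 0 = 0"
    by (simp add: a_def x0)
  ultimately show ?thesis
    by (intro exI[of _ a]) (simp add: fps_eq_iff)
qed

section \<open>The Newton-Puiseux theorem\<close>

definition has_root :: "series2 \<Rightarrow> bool" where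
  "has_root F \<longleftrightarrow> (\<exists>n>0. \<exists>x. fps_nth x 0 = 0 \<and> eval_x x (ramify2 n F) = 0)"

lemma has_root_ramify2: "m > 0 \<Longrightarrow> has_root (ramify2 m F) \<Longrightarrow> has_root F"
  unfolding has_root_def by (metis ramify2_ramify2 nat_0_less_mult_iff)

lemma has_root_shift_x:
  assumes s0: "fps_nth s 0 = 0" and "has_root (shift_x s F)"
  shows "has_root F"
proof -
  obtain n x where "n > 0" "fps_nth x 0 = 0" "eval_x x (ramify2 n (shift_x s F)) = 0"
    using assms(2) unfolding has_root_def by auto
  then have "eval_x ((s oo fps_X ^ n) + x) (ramify2 n F) = 0"
    using s0 by (simp add: ramify2_shift_x eval_x_shift_x)
  then show ?thesis
    unfolding has_root_def using \<open>n > 0\<close> \<open>fps_nth x 0 = 0\<close> s0 by (intro exI conjI) auto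
qed

text \<open>The substitution \<open>x = t\<^sup>p w\<close>, after which a power of \<open>t\<close> can be divided out: \<open>H\<close> is
\<open>t\<^sup>-\<^sup>b K(t\<^sup>p w, t)\<close>.\<close>
lemma has_root_rescale:
  assumes "p > 0" and scale: "\<And>j. fps_nth K j * fps_X ^ (p * j) = fps_X ^ b * fps_nth H j"
    and "has_root H"
  shows "has_root K"
proof -
  obtain n w where n: "n > 0" "fps_nth w 0 = 0" "eval_x w (ramify2 n H) = 0"
    using assms(3) unfolding has_root_def by auto
  define X where "X = (fps_X :: complex fps) ^ n"
  have X_power: "fps_X ^ k oo fps_X ^ n = X ^ k" for k
    using n(1) by (simp add: X_def fps_X_power_compose)
  have *: "fps_nth (ramify2 n K) j * X ^ (p * j) = X ^ b * fps_nth (ramify2 n H) j" for j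
  proof -
    have "(fps_nth K j * fps_X ^ (p * j)) oo fps_X ^ n = (fps_X ^ b * fps_nth H j) oo fps_X ^ n"
      by (simp only: scale)
    then show ?thesis
      using n(1) by (simp add: fps_compose_mult_distrib X_power)
  qed
  have "fps_nth (ramify2 n K) i * (X ^ p * w) ^ i =
      fps_nth (fps_const (X ^ b) * ramify2 n H) i * w ^ i" for i
  proof -
    have "fps_nth (ramify2 n K) i * (X ^ p * w) ^ i = (fps_nth (ramify2 n K) i * X ^ (p * i)) * w ^ i"
      by (simp add: power_mult_distrib power_mult)
    then show ?thesis
      by (simp only: *) simp
  qed
  then have "eval_x (X ^ p * w) (ramify2 n K) = eval_x w (fps_const (X ^ b) * ramify2 n H)"
    unfolding eval_x_def by simp
  then have "eval_x (X ^ p * w) (ramify2 n K) = 0"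
    using n by (simp add: eval_x_const_mult)
  then show ?thesis
    unfolding has_root_def using n by (intro exI conjI) auto
qed

lemma pcompose_power: "pcompose (p ^ n) q = pcompose p q ^ n"
  for p q :: "'a::comm_ring_1 poly"
  by (induction n) (simp_all add: pcompose_1 pcompose_mult)

lemma coeff_Taylor_shift:
  fixes e :: "nat \<Rightarrow> 'a::comm_ring_1"
  assumes "j \<le> d"
  shows "coeff (pcompose (\<Sum>i\<le>d. monom (e i) i) [:c, 1:]) j =
    (\<Sum>i\<le>d - j. of_nat ((i + j) choose j) * e (i + j) * c ^ i)"
proof -
  have linear: "coeff ([:c, 1:] ^ i) j = of_nat (i choose j) * c ^ (i - j)" for i
  proof (cases "j \<le> i")
    case False
    then show ?thesis
      by (metis binomial_eq_0 coeff_eq_0 degree_linear_power linorder_not_le mult_zero_left of_nat_0)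
  qed (simp add: coeff_linear_poly_power)
  have "coeff (pcompose (\<Sum>i\<le>d. monom (e i) i) [:c, 1:]) j =
      (\<Sum>i\<le>d. e i * (of_nat (i choose j) * c ^ (i - j)))"
    by (simp add: pcompose_sum coeff_sum monom_altdef pcompose_smult linear
        pcompose_pCons pcompose_power)
  also have "\<dots> = (\<Sum>i\<in>{j..d}. e i * (of_nat (i choose j) * c ^ (i - j)))"
    by (rule sum.mono_neutral_right) (auto simp: binomial_eq_0)
  also have "\<dots> = (\<Sum>i\<le>d - j. of_nat ((i + j) choose j) * e (i + j) * c ^ i)"
    by (rule sum.reindex_bij_witness[of _ "\<lambda>i. i + j" "\<lambda>i. i - j"]) (use assms in auto)
  finally show ?thesis .
qed

lemma Taylor_shift_order:
  fixes p :: "complex poly"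
  assumes "p \<noteq> 0"
  shows "j < order c p \<Longrightarrow> coeff (pcompose p [:c, 1:]) j = 0"
    and "coeff (pcompose p [:c, 1:]) (order c p) \<noteq> 0"
proof -
  obtain q where q: "p = [:- c, 1:] ^ order c p * q" "\<not> [:- c, 1:] dvd q"
    using order_decomp[OF assms] by blast
  have "pcompose p [:c, 1:] = monom 1 (order c p) * pcompose q [:c, 1:]"
    by (subst q(1)) (simp add: pcompose_mult pcompose_power pcompose_pCons monom_altdef)
  moreover have "coeff (pcompose q [:c, 1:]) 0 \<noteq> 0"
    using q(2) by (simp add: pcompose_coeff_0 poly_eq_0_iff_dvd)
  ultimately show "j < order c p \<Longrightarrow> coeff (pcompose p [:c, 1:]) j = 0"
    and "coeff (pcompose p [:c, 1:]) (order c p) \<noteq> 0"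
    by (simp_all add: coeff_monom_mult)
qed

text \<open>This is what the vanishing of the second highest coefficient is for: a polynomial \<open>k (z - c)\<^sup>d\<close> with
this property has \<open>c = 0\<close>, hence is a monomial.\<close>
lemma exists_root_of_small_order:
  fixes p :: "complex poly"
  assumes "degree p > 0" and "coeff p (degree p - 1) = 0" and "i < degree p" "coeff p i \<noteq> 0"
  shows "\<exists>c. 0 < order c p \<and> order c p < degree p"
proof -
  have "p \<noteq> 0"
    using assms(1) by auto
  obtain c where "poly p c = 0"
    using assms(1) fundamental_theorem_of_algebra_alt[of p] by (metis degree_pCons_0 not_less_zero)
  then have "0 < order c p"
    using \<open>p \<noteq> 0\<close> by (simp add: order_root)
  moreover have "order c p \<noteq> degree p"
  proof
    assume eq: "order c p = degree p"
    obtain q where q: "p = [:- c, 1:] ^ degree p * q" "\<not> [:- c, 1:] dvd q"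
      using order_decomp[OF \<open>p \<noteq> 0\<close>, of c] eq by auto
    have "q \<noteq> 0"
      using q(2) by auto
    then have "degree p = degree p + degree q"
      by (subst q(1)) (simp add: degree_mult_eq degree_linear_power)
    then obtain k where k: "q = [:k:]"
      by (metis add_cancel_right_right degree_eq_zeroE)
    define d where "d = degree p"
    have p: "p = smult k ([:- c, 1:] ^ d)"
      using q(1) k by (simp add: d_def mult.commute)
    have "k \<noteq> 0"
      using k \<open>q \<noteq> 0\<close> by auto
    have "coeff p (d - 1) = k * (of_nat (d choose (d - 1)) * (- c))"
    proof -
      obtain d' where "d = Suc d'"
        using assms(1) by (cases d) (simp_all add: d_def)
      then show ?thesis
        using coeff_linear_poly_power[of d' d "- c" 1] by (simp add: p del: power_Suc)
    qed
    then have "c = 0"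
      using assms(1,2) \<open>k \<noteq> 0\<close> by (auto simp: d_def[symmetric] binomial_eq_0_iff)
    then have "p = monom k d"
      by (simp add: p monom_altdef)
    then show False
      using assms(3,4) \<open>k \<noteq> 0\<close> by (auto simp: degree_monom_eq split: if_splits)
  qed
  ultimately show ?thesis
    using order_degree[OF \<open>p \<noteq> 0\<close>, of c] by (intro exI[of _ c]) simp
qed


text \<open>The line through \<open>(d, 0)\<close> and \<open>(i, ord G\<^sub>i)\<close> has no point \<open>(j, ord G\<^sub>j)\<close> below it, so it carries the edge of
the Newton polygon that ends in \<open>(d, 0)\<close>. The comparison of slopes is cleared of denominators.\<close>
lemma vertex_of_Newton_polygon:
  fixes G :: "nat \<Rightarrow> complex fps"
  assumes "G 0 \<noteq> 0" and "d > 0"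
  shows "\<exists>i<d. G i \<noteq> 0 \<and> (\<forall>j<d. G j \<noteq> 0 \<longrightarrow>
    subdegree (G i) * (d - j) \<le> subdegree (G j) * (d - i))"
proof -
  let ?I = "{i. i < d \<and> G i \<noteq> 0}" and ?s = "\<lambda>i. real (subdegree (G i)) / real (d - i)"
  have "finite ?I" "?I \<noteq> {}"
    using assms by auto
  then have "arg_min_on ?s ?I \<in> ?I" "\<And>j. j \<in> ?I \<Longrightarrow> ?s (arg_min_on ?s ?I) \<le> ?s j"
    by (rule arg_min_if_finite(1), rule arg_min_least)
  then obtain i where i: "i \<in> ?I" "\<And>j. j \<in> ?I \<Longrightarrow> ?s i \<le> ?s j"
    by blast
  have "subdegree (G i) * (d - j) \<le> subdegree (G j) * (d - i)" if "j < d" "G j \<noteq> 0" for j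
  proof -
    have "real (subdegree (G i)) * real (d - j) \<le> real (subdegree (G j)) * real (d - i)"
      using i(2)[of j] i(1) that by (simp add: field_simps)
    then show ?thesis
      by (simp only: of_nat_mult[symmetric] of_nat_le_iff)
  qed
  then show ?thesis
    using i(1) by auto
qed

text \<open>The coefficient of \<open>x\<^sup>d\<^sup>-\<^sup>1\<close> in \<open>F(s + x)\<close> is the value at \<open>s\<close> of a divided derivative of \<open>F\<close> that has
order \<open>1\<close> in \<open>x\<close> at \<open>t = 0\<close>, so that the implicit function theorem makes it vanish.\<close>
lemma Tschirnhaus:
  fixes F :: series2
  assumes "\<And>j. j < d \<Longrightarrow> fps_nth (fps_nth F j) 0 = 0" and "fps_nth (fps_nth F d) 0 \<noteq> 0" and "d > 0"
  shows "\<exists>s. fps_nth s 0 = 0 \<and> fps_nth (shift_x s F) (d - 1) = 0"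
proof -
  have "\<exists>s. fps_nth s 0 = 0 \<and> eval_x s (hasse (d - 1) F) = 0"
  proof (rule formal_implicit_function)
    show "fps_nth (fps_nth (hasse (d - 1) F) 0) 0 = 0"
      using assms by (simp add: hasse_def)
    have "fps_nth (hasse (d - 1) F) 1 = fps_const (of_nat (d choose (d - 1))) * fps_nth F d"
      using assms(3) by (simp add: hasse_def fps_of_nat)
    then show "fps_nth (fps_nth (hasse (d - 1) F) 1) 0 \<noteq> 0"
      using assms(2) by (simp add: fps_mult_left_const_nth binomial_eq_0_iff)
  qed
  then show ?thesis
    by (simp add: shift_x_def)
qed

text \<open>If no coefficient of \<open>G\<close> lies below the line of slope \<open>p\<close> through \<open>(d, 0)\<close>, then the shift by \<open>c t\<^sup>p\<close>
keeps it so and acts on the coefficients on the line by replacing the edge polynomial \<open>e(z)\<close> by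
\<open>e(z + c)\<close>.\<close>
lemma shift_x_edge:
  fixes G :: series2 and c :: complex
  assumes "p > 0"
    and above: "\<And>j k. j < d \<Longrightarrow> k < p * (d - j) \<Longrightarrow> fps_nth (fps_nth G j) k = 0"
    and "j \<le> d"
  defines "K \<equiv> shift_x (fps_const c * fps_X ^ p) G"
  shows "k < p * (d - j) \<Longrightarrow> fps_nth (fps_nth K j) k = 0"
    and "fps_nth (fps_nth K j) (p * (d - j)) =
      coeff (pcompose (\<Sum>i\<le>d. monom (fps_nth (fps_nth G i) (p * (d - i))) i) [:c, 1:]) j"
proof -
  have K: "fps_nth (fps_nth K j) k = (\<Sum>i\<le>k. of_nat ((i + j) choose j) * c ^ i *
      (if k < p * i then 0 else fps_nth (fps_nth G (i + j)) (k - p * i)))" for k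
  proof -
    have "fps_nth ((of_nat m * g) * (fps_const c * fps_X ^ p) ^ i) k =
        of_nat m * c ^ i * (if k < p * i then 0 else fps_nth g (k - p * i))" for m g i
    proof -
      have "(of_nat m * g) * (fps_const c * fps_X ^ p) ^ i =
          fps_const (of_nat m * c ^ i) * (fps_X ^ (p * i) * g)"
        unfolding power_mult_distrib fps_const_power power_mult fps_of_nat[symmetric] fps_const_mult[symmetric]
        by (simp only: mult_ac)
      then show ?thesis
        by (simp only: fps_mult_left_const_nth fps_X_power_mult_nth)
    qed
    then show ?thesis
      by (simp add: K_def shift_x_def hasse_def eval_x_def)
  qed
  have vanish: "(if k < p * i then 0 else fps_nth (fps_nth G (i + j)) (k - p * i)) = 0"
    if "k < p * (d - j)" for k i
  proof (cases "k < p * i")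
    case False
    then have "p * i < p * (d - j)"
      using that by linarith
    then have "i < d - j"
      by simp
    moreover have "p * (d - j) = p * i + p * (d - (i + j))"
      using \<open>i < d - j\<close> by (simp add: add_mult_distrib2[symmetric])
    then have "k - p * i < p * (d - (i + j))"
      using False that by linarith
    ultimately show ?thesis
      using above[of "i + j"] False by simp
  qed simp
  show "fps_nth (fps_nth K j) k = 0" if "k < p * (d - j)"
    unfolding K using vanish[OF that] by simp
  have "fps_nth (fps_nth K j) (p * (d - j)) = (\<Sum>i\<le>d - j. of_nat ((i + j) choose j) * c ^ i *
      (if p * (d - j) < p * i then 0 else fps_nth (fps_nth G (i + j)) (p * (d - j) - p * i)))"
    unfolding K by (rule sum.mono_neutral_right) (use assms(1) in auto)
  also have "\<dots> = (\<Sum>i\<le>d - j. of_nat ((i + j) choose j) *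
      fps_nth (fps_nth G (i + j)) (p * (d - (i + j))) * c ^ i)"
  proof (intro sum.cong refl)
    fix i assume "i \<in> {..d - j}"
    then have "\<not> p * (d - j) < p * i" and "p * (d - j) - p * i = p * (d - (i + j))"
      by (simp_all add: diff_mult_distrib2[symmetric] add.commute)
    then show "of_nat ((i + j) choose j) * c ^ i *
        (if p * (d - j) < p * i then 0 else fps_nth (fps_nth G (i + j)) (p * (d - j) - p * i)) =
      of_nat ((i + j) choose j) * fps_nth (fps_nth G (i + j)) (p * (d - (i + j))) * c ^ i"
      by (simp only: if_False mult_ac)
  qed
  also have "\<dots> = coeff (pcompose (\<Sum>i\<le>d. monom (fps_nth (fps_nth G i) (p * (d - i))) i) [:c, 1:]) j"
    using coeff_Taylor_shift[OF assms(3), of "\<lambda>i. fps_nth (fps_nth G i) (p * (d - i))" c] by (simp only:)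
  finally show "fps_nth (fps_nth K j) (p * (d - j)) =
      coeff (pcompose (\<Sum>i\<le>d. monom (fps_nth (fps_nth G i) (p * (d - i))) i) [:c, 1:]) j" .
qed

text \<open>Induction on the order \<open>d\<close> of \<open>F(x, 0)\<close>. After a shift of \<open>x\<close> the coefficient of \<open>x\<^sup>d\<^sup>-\<^sup>1\<close> vanishes, and
after a ramification the edge of the Newton polygon that ends in \<open>(d, 0)\<close> has an integral slope \<open>p\<close>.
Its edge polynomial has degree \<open>d\<close>, no term of degree \<open>d - 1\<close> and a further term, hence a root \<open>c\<close> of
multiplicity less than \<open>d\<close>. The substitution \<open>x = t\<^sup>p (c + w)\<close> and division by \<open>t\<^sup>p\<^sup>d\<close> give a series
whose order in \<open>w\<close> at \<open>t = 0\<close> is this multiplicity.\<close>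
theorem has_root_of_order:
  fixes F :: series2
  assumes "\<And>j. j < d \<Longrightarrow> fps_nth (fps_nth F j) 0 = 0" and "fps_nth (fps_nth F d) 0 \<noteq> 0" and "d > 0"
  shows "has_root F"
  using assms
proof (induction d arbitrary: F rule: less_induct)
  case (less d F)
  obtain s where s: "fps_nth s 0 = 0" "fps_nth (shift_x s F) (d - 1) = 0"
    using Tschirnhaus[OF less.prems] by blast
  define G0 where "G0 = shift_x s F"
  have low: "fps_nth (fps_nth G0 j) 0 = 0" if "j < d" for j
    using less.prems(1)[OF that] by (simp add: G0_def shift_x_nth_0)
  have top: "fps_nth (fps_nth G0 d) 0 \<noteq> 0"
    using less.prems(2) by (simp add: G0_def shift_x_nth_0)
  have "has_root G0"
  proof (cases "fps_nth G0 0 = 0")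
    case True
    then have "eval_x 0 (ramify2 (Suc 0) G0) = 0"
      using eval_x_unfold[of 0 G0] by simp
    then show ?thesis
      unfolding has_root_def by (intro exI[of _ "Suc 0"] exI[of _ 0] conjI) auto
  next
    case False
    obtain i where i: "i < d" "fps_nth G0 i \<noteq> 0" and slope: "\<And>j. j < d \<Longrightarrow> fps_nth G0 j \<noteq> 0 \<Longrightarrow>
        subdegree (fps_nth G0 i) * (d - j) \<le> subdegree (fps_nth G0 j) * (d - i)"
      using vertex_of_Newton_polygon[of "fps_nth G0" d] False less.prems(3) by blast
    define p q where "p = subdegree (fps_nth G0 i)" and "q = d - i"
    have "p > 0"
      using i low[OF i(1)] unfolding p_def by (metis gr0I nth_subdegree_nonzero)
    have "q > 0"
      using i by (simp add: q_def)
    define G where "G = ramify2 q G0"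
    have above: "fps_nth (fps_nth G j) k = 0" if "j < d" "k < p * (d - j)" for j k
    proof (cases "q dvd k \<and> fps_nth G0 j \<noteq> 0")
      case True
      then obtain l where l: "k = q * l"
        by blast
      have "q * l < p * (d - j)"
        using that(2) l by simp
      also have "\<dots> \<le> subdegree (fps_nth G0 j) * q"
        using slope[OF that(1)] True by (simp only: p_def q_def simp_thms)
      finally have "q * l < q * subdegree (fps_nth G0 j)"
        by (simp only: mult.commute)
      then have "fps_nth (fps_nth G0 j) l = 0"
        by (intro nth_less_subdegree_zero) simp
      then show ?thesis
        using \<open>q > 0\<close> by (simp add: G_def fps_nth_compose_X_power l)
    qed (auto simp: G_def fps_nth_compose_X_power)
    define e where "e j = fps_nth (fps_nth G j) (p * (d - j))" for j
    \<comment> \<open>The coefficients on the edge from the vertex i to (d, 0), as a polynomial.\<close>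
    define E where "E = (\<Sum>j\<le>d. monom (e j) j)"
    have coeff_E: "coeff E j = (if j \<le> d then e j else 0)" for j
      by (simp add: E_def coeff_sum)
    have "e d \<noteq> 0"
      using top \<open>q > 0\<close> by (simp add: e_def G_def fps_nth_compose_X_power)
    have "e (d - 1) = 0"
      using s(2) by (simp add: e_def G_def G0_def)
    have "e i \<noteq> 0"
      using i \<open>q > 0\<close> by (simp add: e_def G_def fps_nth_compose_X_power p_def flip: q_def)
    have "degree E = d"
      using \<open>e d \<noteq> 0\<close> by (intro antisym degree_le le_degree) (auto simp: coeff_E)
    then have "E \<noteq> 0"
      using less.prems(3) by auto
    obtain c where c: "0 < order c E" "order c E < d"
    proof -
      have "coeff E (d - 1) = 0" "coeff E i \<noteq> 0"
        using \<open>e (d - 1) = 0\<close> \<open>e i \<noteq> 0\<close> i(1) by (simp_all add: coeff_E)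
      then show thesis
        using exists_root_of_small_order[of E i, unfolded \<open>degree E = d\<close>] less.prems(3) i(1) that by blast
    qed
    define K where "K = shift_x (fps_const c * fps_X ^ p) G"
    have edge0: "fps_nth (fps_nth K j) k = 0" if "j \<le> d" "k < p * (d - j)" for j k
      unfolding K_def by (rule shift_x_edge(1)[OF \<open>p > 0\<close> _ that]) (rule above)
    have edge: "fps_nth (fps_nth K j) (p * (d - j)) = coeff (pcompose E [:c, 1:]) j"
      if "j \<le> d" for j
      unfolding K_def E_def e_def by (rule shift_x_edge(2)[OF \<open>p > 0\<close> _ that]) (rule above)
    \<comment> \<open>Rescaling: H(w, t) is K(t^p w, t) divided by t^(p d).\<close>
    define H where "H = Abs_fps (\<lambda>j. if j \<le> d then fps_shift (p * (d - j)) (fps_nth K j)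
      else fps_X ^ (p * (j - d)) * fps_nth K j)"
    have "fps_nth K j * fps_X ^ (p * j) = fps_X ^ (p * d) * fps_nth H j" for j
    proof (cases "j \<le> d")
      case True
      have K_eq: "fps_nth K j = fps_X ^ (p * (d - j)) * fps_nth H j"
      proof (rule fps_ext)
        fix k
        show "fps_nth (fps_nth K j) k = fps_nth (fps_X ^ (p * (d - j)) * fps_nth H j) k"
          using edge0[OF True, of k] True by (auto simp: fps_X_power_mult_nth H_def)
      qed
      have "fps_X ^ (p * (d - j)) * fps_X ^ (p * j) = (fps_X :: complex fps) ^ (p * d)"
        using True by (simp add: power_add[symmetric] distrib_left[symmetric])
      then show ?thesis
        unfolding K_eq by (metis mult.assoc mult.commute)
    next
      case False
      then have "fps_X ^ (p * j) = (fps_X :: complex fps) ^ (p * d) * fps_X ^ (p * (j - d))"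
        by (simp add: power_add[symmetric] distrib_left[symmetric])
      then show ?thesis
        using False by (simp add: H_def mult_ac)
    qed
    moreover have "has_root H"
    proof (rule less.IH)
      have H0: "fps_nth (fps_nth H j) 0 = coeff (pcompose E [:c, 1:]) j" if "j \<le> d" for j
        using edge[OF that] that by (simp add: H_def)
      show "fps_nth (fps_nth H j) 0 = 0" if "j < order c E" for j
        using H0[of j] Taylor_shift_order(1)[OF \<open>E \<noteq> 0\<close> that] that c by simp
      show "fps_nth (fps_nth H (order c E)) 0 \<noteq> 0"
        using H0[of "order c E"] Taylor_shift_order(2)[OF \<open>E \<noteq> 0\<close>, of c] c by simp
    qed (fact c)+
    ultimately have "has_root K"
      using has_root_rescale[OF \<open>p > 0\<close>] by blast
    then have "has_root G"
      unfolding K_def by (rule has_root_shift_x[rotated]) (use \<open>p > 0\<close> in simp)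
    then show ?thesis
      unfolding G_def by (rule has_root_ramify2[OF \<open>q > 0\<close>])
  qed
  then show ?case
    unfolding G0_def by (rule has_root_shift_x[OF s(1)])
qed

text \<open>Dividing by a linear factor lowers the order of \<open>F(x, 0)\<close> by one.\<close>
theorem Newton_Puiseux_regular:
  fixes F :: series2
  assumes "\<And>j. j < d \<Longrightarrow> fps_nth (fps_nth F j) 0 = 0" and "fps_nth (fps_nth F d) 0 \<noteq> 0"
  shows "\<exists>n>0. \<exists>V xs. fps_nth (fps_nth V 0) 0 \<noteq> 0 \<and> (\<forall>x\<in>set xs. fps_nth x 0 = 0) \<and>
    ramify2 n F = V * (\<Prod>x\<leftarrow>xs. fps_X - fps_const x)"
  using assms
proof (induction d arbitrary: F)
  case 0
  then show ?case
    by (intro exI[of _ "Suc 0"] conjI exI[of _ F] exI[of _ "[]"]) simp_all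
next
  case (Suc d F)
  obtain r x where r: "r > 0" and x: "fps_nth x 0 = 0" "eval_x x (ramify2 r F) = 0"
    using has_root_of_order[OF Suc.prems] unfolding has_root_def by auto
  then obtain Q where Q: "ramify2 r F = (fps_X - fps_const x) * Q"
    using linear_factor_dvd_iff by (metis dvdE)
  have Q0: "fps_nth (fps_nth Q j) 0 = fps_nth (fps_nth F (Suc j)) 0" for j
  proof -
    have "fps_nth (fps_nth (ramify2 r F) (Suc j)) 0 = fps_nth (fps_nth Q j) 0"
      unfolding Q using x(1) by (simp add: left_diff_distrib)
    then show ?thesis
      by simp
  qed
  obtain n V xs where n: "n > 0" and V: "fps_nth (fps_nth V 0) 0 \<noteq> 0" and
    xs: "\<forall>x\<in>set xs. fps_nth x 0 = 0" "ramify2 n Q = V * (\<Prod>x\<leftarrow>xs. fps_X - fps_const x)"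
    using Suc.IH[of Q] Suc.prems by (auto simp: Q0)
  have "ramify2 (r * n) F = (fps_X - fps_const (x oo fps_X ^ n)) * ramify2 n Q"
    using ramify2_ramify2[OF r n, of F] n by (simp add: Q ramify2_mult ramify2_diff)
  then have "ramify2 (r * n) F = V * (\<Prod>x\<leftarrow>(x oo fps_X ^ n) # xs. fps_X - fps_const x)"
    by (simp add: xs(2) mult_ac)
  then show ?case
    using r n V xs(1) x(1)
    by (intro exI[of _ "r * n"] conjI exI[of _ V] exI[of _ "(x oo fps_X ^ n) # xs"]) simp_all
qed

theorem Newton_Puiseux:
  fixes F :: series2
  assumes "F \<noteq> 0"
  shows "\<exists>n>0. \<exists>M V xs. fps_nth (fps_nth V 0) 0 \<noteq> 0 \<and> (\<forall>x\<in>set xs. fps_nth x 0 = 0) \<and>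
    ramify2 n F = V * fps_const (fps_X ^ M) * (\<Prod>x\<leftarrow>xs. fps_X - fps_const x)"
proof -
  define M where "M = (LEAST k. \<exists>j. fps_nth (fps_nth F j) k \<noteq> 0)"
  obtain k0 j0 where "fps_nth (fps_nth F j0) k0 \<noteq> 0"
    using assms by (metis fps_ext fps_zero_nth)
  then have ex: "\<exists>j. fps_nth (fps_nth F j) M \<noteq> 0"
    unfolding M_def by (intro LeastI_ex[of "\<lambda>k. \<exists>j. fps_nth (fps_nth F j) k \<noteq> 0"]) blast
  have below: "fps_nth (fps_nth F j) k = 0" if "k < M" for j k
    using not_less_Least[OF that[unfolded M_def]] by blast
  define F' where "F' = Abs_fps (\<lambda>j. fps_shift M (fps_nth F j))"
  have F: "F = fps_const (fps_X ^ M) * F'"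
    by (intro fps_ext) (simp add: F'_def fps_X_power_mult_nth below)
  define d where "d = (LEAST j. fps_nth (fps_nth F' j) 0 \<noteq> 0)"
  have d: "fps_nth (fps_nth F' d) 0 \<noteq> 0"
    unfolding d_def by (rule LeastI_ex) (use ex in \<open>simp add: F'_def\<close>)
  have "fps_nth (fps_nth F' j) 0 = 0" if "j < d" for j
    using not_less_Least[OF that[unfolded d_def]] by blast
  from Newton_Puiseux_regular[OF this d] obtain n V xs where n: "n > 0"
    and V: "fps_nth (fps_nth V 0) 0 \<noteq> 0" and xs: "\<forall>x\<in>set xs. fps_nth x 0 = 0"
    and F': "ramify2 n F' = V * (\<Prod>x\<leftarrow>xs. fps_X - fps_const x)"
    by blast
  have "ramify2 n F = V * fps_const (fps_X ^ (n * M)) * (\<Prod>x\<leftarrow>xs. fps_X - fps_const x)"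
    using n by (subst F) (simp add: ramify2_mult F' fps_X_power_compose mult_ac flip: power_mult)
  then show ?thesis
    using n V xs by blast
qed

section \<open>Arcs and their ramifications\<close>

lemma denominator_mult:
  assumes "denominator n a" and "k > 0"
  shows "denominator (n * k) a"
proof -
  have "\<exists>j::nat. e = real j / real (n * k)" if "a e \<noteq> 0" for e
  proof -
    obtain i :: nat where "e = real i / real n"
      using assms(1) \<open>a e \<noteq> 0\<close> by (auto simp: denominator_def)
    then have "e = real (i * k) / real (n * k)"
      using assms by (simp add: denominator_def)
    then show ?thesis by blast
  qed
  then show ?thesis
    using assms by (simp add: denominator_def)
qed

lemma ramify_nth [simp]: "fps_nth (ramify n a) k = a (real k / real n)"
  by (simp add: ramify_def)

lemma ramify_mult:
  assumes "denominator n a" and "k > 0"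
  shows "ramify (n * k) a = ramify n a oo fps_X ^ k"
proof (rule fps_ext)
  fix j
  have "n > 0"
    using assms by (simp add: denominator_def)
  show "fps_nth (ramify (n * k) a) j = fps_nth (ramify n a oo fps_X ^ k) j"
  proof (cases "k dvd j")
    case True
    then obtain i where "j = k * i"
      by blast
    then show ?thesis
      using assms(2) \<open>n > 0\<close> by (simp add: fps_nth_compose_X_power field_simps)
  next
    case False
    have "a (real j / real (n * k)) = 0"
    proof (rule ccontr)
      assume "a (real j / real (n * k)) \<noteq> 0"
      then obtain i :: nat where "real j / real (n * k) = real i / real n"
        using assms(1) by (auto simp: denominator_def)
      then have "real j = real (k * i)"
        using \<open>n > 0\<close> assms(2) by (simp add: field_simps)
      then show False
        using False by (metis dvd_triv_left of_nat_eq_iff)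
    qed
    then show ?thesis
      using False by (simp add: fps_nth_compose_X_power)
  qed
qed

lemma ramify_inject:
  assumes "denominator n a" "denominator n b" "ramify n a = ramify n b"
  shows "a = b"
proof
  fix e
  show "a e = b e"
  proof (cases "\<exists>k::nat. e = real k / real n")
    case True
    then show ?thesis
      using assms(3) by (metis ramify_nth)
  next
    case False
    then show ?thesis
      using assms(1,2) unfolding denominator_def by metis
  qed
qed

lemma unramify_nth: "n > 0 \<Longrightarrow> unramify n S (real k / real n) = fps_nth S k"
  by (simp add: unramify_def)

lemma denominator_unramify: "n > 0 \<Longrightarrow> denominator n (unramify n S)"
  unfolding denominator_def unramify_def
proof (intro conjI allI impI)
  fix e :: real
  assume n: "0 < n" and "(if 0 \<le> e \<and> real n * e \<in> \<int> then fps_nth S (nat \<lfloor>real n * e\<rfloor>) else 0) \<noteq> 0"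
  then have "0 \<le> e" "real n * e \<in> \<int>"
    by (auto split: if_splits)
  then have "real n * e = real (nat \<lfloor>real n * e\<rfloor>)"
    by simp
  then have "e = real (nat \<lfloor>real n * e\<rfloor>) / real n"
    using n by (simp add: field_simps)
  then show "\<exists>k::nat. e = real k / real n"
    by blast
qed simp

lemma ramify_unramify: "n > 0 \<Longrightarrow> ramify n (unramify n S) = S"
  by (rule fps_ext) (simp add: unramify_nth)

lemma unramify_compose:
  assumes "n > 0" "k > 0"
  shows "unramify (n * k) (S oo fps_X ^ k) = unramify n S"
  by (rule ramify_inject[of "n * k"])
     (use assms in \<open>simp_all add: denominator_unramify denominator_mult ramify_unramify ramify_mult\<close>)

lemma unramify_eq_0_iff: "n > 0 \<Longrightarrow> unramify n S = (\<lambda>_. 0) \<longleftrightarrow> S = 0"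
  by (metis fps_ext fps_zero_nth unramify_nth unramify_def)

lemma ord_y_unramify:
  assumes "n > 0" "S \<noteq> 0"
  shows "ord_y (unramify n S) = ereal (real (subdegree S) / real n)"
  unfolding ord_y_def
proof (rule INF_eqI)
  fix e assume "e \<in> {e. unramify n S e \<noteq> 0}"
  then obtain k where k: "e = real k / real n" "fps_nth S k \<noteq> 0"
    using denominator_unramify[OF assms(1), of S] unramify_nth[OF assms(1), of S]
    unfolding denominator_def by auto
  then have "subdegree S \<le> k"
    by (intro subdegree_leI)
  then show "ereal (real (subdegree S) / real n) \<le> ereal e"
    using assms(1) k(1) by (simp add: divide_right_mono)
next
  fix y assume "\<And>e. e \<in> {e. unramify n S e \<noteq> 0} \<Longrightarrow> y \<le> ereal e"
  then show "y \<le> ereal (real (subdegree S) / real n)"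
    using assms by (simp add: unramify_nth)
qed

lemma denominator_least: "is_arc a \<Longrightarrow> denominator (least_denominator a) a"
  unfolding is_arc_def least_denominator_def by (rule LeastI_ex)

text \<open>Evaluation along an arc can be computed at any level of ramification, not only at the least one, by
which it is defined. This allows all arcs to be treated at one common level.\<close>
lemma eval_arc_eq:
  assumes a: "denominator m a" and a0: "a 0 = 0"
  shows "eval_arc F a = unramify m (eval_x (ramify m a) (ramify2 m F))"
proof -
  define n where "n = least_denominator a"
  have n: "denominator n a"
    unfolding n_def using a by (intro denominator_least) (auto simp: is_arc_def)
  have pos: "n > 0" "m > 0"
    using n a by (simp_all add: denominator_def)
  have ramify0: "fps_nth (ramify k a) 0 = 0" for k
    by (simp add: a0)
  have "eval_arc F a = unramify n (eval_x (ramify n a) (ramify2 n F))"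
  proof -
    have "(\<Sum>i. fps_nth (fps_nth (ramify2 n F) i * ramify n a ^ i) k) =
        (\<Sum>i\<le>k. fps_nth (fps_nth (ramify2 n F) i * ramify n a ^ i) k)" for k
      by (rule suminf_finite) (auto intro!: fps_power_nth_below ramify0)
    then show ?thesis
      by (simp add: eval_arc_def eval_x_def Let_def n_def del: ramify2_nth)
  qed
  also have "\<dots> = unramify (n * m) (eval_x (ramify n a) (ramify2 n F) oo fps_X ^ m)"
    using pos by (simp add: unramify_compose)
  also have "eval_x (ramify n a) (ramify2 n F) oo fps_X ^ m =
      eval_x (ramify (n * m) a) (ramify2 (n * m) F)"
    using pos n by (simp add: eval_x_ramify2 a0 ramify_mult ramify2_ramify2)
  also have "\<dots> = eval_x (ramify m a) (ramify2 m F) oo fps_X ^ n"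
    using pos a by (simp add: eval_x_ramify2 a0 ramify_mult ramify2_ramify2 mult.commute[of n])
  also have "unramify (n * m) \<dots> = unramify m (eval_x (ramify m a) (ramify2 m F))"
    using pos by (simp add: unramify_compose mult.commute[of n])
  finally show ?thesis .
qed

lemma ord_y_pos_imp: "ord_y a > 0 \<Longrightarrow> a 0 = 0"
  unfolding ord_y_def by (metis (mono_tags, lifting) INF_lower2 leD mem_Collect_eq order_refl zero_ereal_def)

lemma ord_y_pos:
  assumes "denominator n a" "a 0 = 0"
  shows "ord_y a > 0"
proof -
  have "ereal (1 / real n) \<le> ord_y a"
    unfolding ord_y_def
  proof (rule INF_greatest)
    fix e assume e: "e \<in> {e. a e \<noteq> 0}"
    then obtain k :: nat where k: "e = real k / real n"
      using assms(1) by (auto simp: denominator_def)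
    then have "k \<noteq> 0"
      using e assms(2) by (cases k) auto
    then show "ereal (1 / real n) \<le> ereal e"
      using k assms(1) by (simp add: denominator_def divide_right_mono)
  qed
  moreover have "0 < ereal (1 / real n)"
    using assms(1) by (simp add: denominator_def)
  ultimately show ?thesis
    by (rule less_le_trans[rotated])
qed

section \<open>Factorisations at a common level\<close>

text \<open>A formal version of the Newton-Puiseux factorisation which fixes the level \<open>n\<close>; the exponent \<open>M\<close> counts
powers of \<open>t\<close>, where \<open>y = t\<^sup>n\<close>, and the unit may be a divergent series.\<close>
definition puiseux_at :: "nat \<Rightarrow> series2 \<Rightarrow> fracseries list \<Rightarrow> bool" where
  "puiseux_at n F rs \<longleftrightarrow> n > 0 \<and> (\<forall>a\<in>set rs. denominator n a \<and> a 0 = 0) \<and>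
    (\<exists>V M. fps_nth (fps_nth V 0) 0 \<noteq> 0 \<and>
      ramify2 n F = V * fps_const (fps_X ^ M) * (\<Prod>a\<leftarrow>rs. fps_X - fps_const (ramify n a)))"

lemma puiseux_at_mult:
  assumes "puiseux_at n F rs" and "k > 0"
  shows "puiseux_at (n * k) F rs"
proof -
  obtain V M where n: "n > 0" and rs: "\<forall>a\<in>set rs. denominator n a \<and> a 0 = 0"
    and V: "fps_nth (fps_nth V 0) 0 \<noteq> 0"
    and F: "ramify2 n F = V * fps_const (fps_X ^ M) * (\<Prod>a\<leftarrow>rs. fps_X - fps_const (ramify n a))"
    using assms(1) unfolding puiseux_at_def by auto
  have "ramify2 (n * k) F = ramify2 k V * fps_const (fps_X ^ (k * M)) *
      (\<Prod>a\<leftarrow>rs. fps_X - fps_const (ramify n a oo fps_X ^ k))"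
    using n assms(2) by (simp add: ramify2_ramify2[symmetric] F ramify2_mult ramify2_prod_list
        fps_X_power_compose power_mult[symmetric] ramify2_diff o_def)
  also have "(\<Prod>a\<leftarrow>rs. fps_X - fps_const (ramify n a oo fps_X ^ k)) =
      (\<Prod>a\<leftarrow>rs. fps_X - fps_const (ramify (n * k) a))"
    using rs assms(2) by (intro arg_cong[where f = prod_list] map_cong) (simp_all add: ramify_mult)
  finally show ?thesis
    unfolding puiseux_at_def using n assms(2) rs V
    by (intro conjI exI[of _ "ramify2 k V"] exI[of _ "k * M"]) (simp_all add: denominator_mult)
qed

lemma puiseux_at_newton_puiseux:
  assumes "newton_puiseux F u E rs"
  shows "\<exists>n. puiseux_at n F rs"
proof -
  obtain n where n: "n > 0" "\<forall>a\<in>set rs. denominator n a" and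
    F: "ramify2 n F = ramify2 n u * fps_const (fps_X ^ (n * E)) *
      (\<Prod>a\<leftarrow>rs. fps_X - fps_const (ramify n a))"
    using assms unfolding newton_puiseux_def by auto
  have "\<forall>a\<in>set rs. a 0 = 0" "fps_nth (fps_nth (ramify2 n u) 0) 0 \<noteq> 0"
    using assms by (auto simp: newton_puiseux_def unit_germ_def coeff2_def ord_y_pos_imp)
  then show ?thesis
    unfolding puiseux_at_def using n F by blast
qed

lemma puiseux_at_exists:
  assumes "F \<noteq> 0"
  shows "\<exists>n rs. puiseux_at n F rs"
proof -
  obtain n M V xs where n: "n > 0" and V: "fps_nth (fps_nth V 0) 0 \<noteq> 0"
    and xs: "\<forall>x\<in>set xs. fps_nth x 0 = 0"
    and F: "ramify2 n F = V * fps_const (fps_X ^ M) * (\<Prod>x\<leftarrow>xs. fps_X - fps_const x)"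
    using Newton_Puiseux[OF assms] by auto
  have "unramify n x 0 = fps_nth x 0" for x
    using unramify_nth[OF n, of x 0] by simp
  then have "puiseux_at n F (map (unramify n) xs)"
    unfolding puiseux_at_def using n V xs F
    by (intro conjI exI[of _ V] exI[of _ M]) (auto simp: denominator_unramify ramify_unramify o_def)
  then show ?thesis by blast
qed

lemma puiseux_at_root_iff:
  assumes "puiseux_at n F rs" and a: "denominator n a" "a 0 = 0"
  shows "eval_x (ramify n a) (ramify2 n F) = 0 \<longleftrightarrow> a \<in> set rs"
proof -
  obtain V M where rs: "\<forall>a\<in>set rs. denominator n a \<and> a 0 = 0"
    and V: "fps_nth (fps_nth V 0) 0 \<noteq> 0"
    and F: "ramify2 n F = V * fps_const (fps_X ^ M) * (\<Prod>a\<leftarrow>rs. fps_X - fps_const (ramify n a))"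
    using assms(1) unfolding puiseux_at_def by auto
  have a0: "fps_nth (ramify n a) 0 = 0"
    by (simp add: a)
  have "eval_x (ramify n a) V \<noteq> 0"
    using V by (metis eval_x_nth_0 fps_zero_nth)
  moreover have "(\<Prod>b\<leftarrow>rs. ramify n a - ramify n b) = 0 \<longleftrightarrow> a \<in> set rs"
  proof
    assume "(\<Prod>b\<leftarrow>rs. ramify n a - ramify n b) = 0"
    then obtain b where "b \<in> set rs" "ramify n a = ramify n b"
      by (auto simp: prod_list_zero_iff)
    then show "a \<in> set rs"
      using ramify_inject[OF a(1), of b] rs by auto
  qed (auto simp: prod_list_zero_iff image_iff)
  ultimately show ?thesis
    using a0 by (simp add: F eval_x_mult eval_x_prod_list eval_x_diff o_def)
qed

lemma eval_arc_eq_0_iff: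
  assumes "puiseux_at n F rs" and "is_arc a" "a 0 = 0"
  shows "eval_arc F a = (\<lambda>_. 0) \<longleftrightarrow> a \<in> set rs"
proof -
  define k where "k = least_denominator a"
  have k: "denominator k a" "k > 0" "n > 0"
    using denominator_least[OF assms(2)] assms(1) by (simp_all add: k_def denominator_def puiseux_at_def)
  then have "denominator (n * k) a"
    by (metis denominator_mult mult.commute)
  then show ?thesis
    using puiseux_at_root_iff[OF puiseux_at_mult[OF assms(1) k(2)]] assms(3) k
    by (simp add: eval_arc_eq unramify_eq_0_iff)
qed

lemma linear_power_dvd_iff:
  fixes a :: "'a::idom fps"
  assumes a0: "fps_nth a 0 = 0" and Q: "eval_x a Q \<noteq> 0"
  shows "(fps_X - fps_const a) ^ j dvd (fps_X - fps_const a) ^ l * Q \<longleftrightarrow> j \<le> l"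
proof
  assume dvd: "(fps_X - fps_const a) ^ j dvd (fps_X - fps_const a) ^ l * Q"
  show "j \<le> l"
  proof (rule ccontr)
    assume "\<not> j \<le> l"
    then have "(fps_X - fps_const a) ^ l * (fps_X - fps_const a) dvd (fps_X - fps_const a) ^ j"
      using le_imp_power_dvd[of "Suc l" j "fps_X - fps_const a"] by (simp add: mult.commute)
    then have *: "(fps_X - fps_const a) ^ l * (fps_X - fps_const a) dvd (fps_X - fps_const a) ^ l * Q"
      using dvd by (rule dvd_trans)
    have "fps_nth (fps_X - fps_const a) 1 \<noteq> 0"
      by simp
    then have "fps_X - fps_const a \<noteq> 0"
      by fastforce
    then have "(fps_X - fps_const a) dvd Q"
      using * by (simp add: dvd_mult_cancel_left)
    then show False
      using Q linear_factor_dvd_iff[OF a0] by blast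
  qed
qed (simp add: dvd_mult2 le_imp_power_dvd)

lemma prod_list_split_count:
  fixes h :: "'b \<Rightarrow> 'a::comm_monoid_mult"
  shows "(\<Prod>g\<leftarrow>gs. h g) = h a ^ count_list gs a * (\<Prod>g\<leftarrow>filter (\<lambda>g. g \<noteq> a) gs. h g)"
  by (induction gs) (simp_all add: mult_ac)

lemma puiseux_at_linear_power_dvd:
  assumes "puiseux_at n F gs" and a: "denominator n a" "a 0 = 0"
  shows "(fps_X - fps_const (ramify n a)) ^ j dvd ramify2 n F \<longleftrightarrow> j \<le> count_list gs a"
proof -
  obtain V M where gs: "\<forall>a\<in>set gs. denominator n a \<and> a 0 = 0"
    and V: "fps_nth (fps_nth V 0) 0 \<noteq> 0"
    and F: "ramify2 n F = V * fps_const (fps_X ^ M) * (\<Prod>a\<leftarrow>gs. fps_X - fps_const (ramify n a))"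
    using assms(1) unfolding puiseux_at_def by auto
  have zero: "fps_nth (ramify n a) 0 = 0"
    by (simp add: a)
  define R where "R = V * fps_const (fps_X ^ M) *
    (\<Prod>g\<leftarrow>filter (\<lambda>g. g \<noteq> a) gs. fps_X - fps_const (ramify n g))"
  have "ramify2 n F = (fps_X - fps_const (ramify n a)) ^ count_list gs a * R"
    by (simp add: F R_def prod_list_split_count[of _ gs a] mult_ac)
  moreover have "eval_x (ramify n a) R \<noteq> 0"
  proof -
    have "eval_x (ramify n a) V \<noteq> 0"
      using V by (metis eval_x_nth_0 fps_zero_nth)
    moreover have "ramify n a - ramify n g \<noteq> 0" if "g \<in> set gs" "g \<noteq> a" for g
      using ramify_inject[OF a(1), of g] gs that by auto
    ultimately show ?thesis
      by (auto simp: R_def eval_x_mult[OF zero] eval_x_prod_list[OF zero] eval_x_diff a o_def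
          prod_list_zero_iff)
  qed
  ultimately show ?thesis
    using linear_power_dvd_iff[OF zero] by simp
qed

text \<open>The multiplicity is defined at the least denominator of \<open>a\<close>, where the factorisation need not exist.
At that level \<open>F = (x - a)\<^sup>l Q\<close> with \<open>Q(a) \<noteq> 0\<close>, and both properties survive the passage to a
common multiple of the two levels, where the multiplicity is read off from the factorisation.\<close>
lemma root_mult_eq_count:
  assumes pui: "puiseux_at m F gs" and "is_arc a" and a0: "a 0 = 0"
  shows "root_mult F a = count_list gs a"
proof -
  define n where "n = least_denominator a"
  have n: "denominator n a" "n > 0" "m > 0"
    using denominator_least[OF assms(2)] assms(1) by (simp_all add: n_def denominator_def puiseux_at_def)
  define L where "L = n * m"
  have L: "denominator L a"
    using n by (simp add: L_def denominator_mult)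
  have aL: "ramify L a = ramify n a oo fps_X ^ m"
    using n by (simp add: L_def ramify_mult)
  have zero: "fps_nth (ramify k a) 0 = 0" for k
    by (simp add: a0)
  let ?l = "fps_X - fps_const (ramify n a)" and ?lL = "fps_X - fps_const (ramify L a)"
  have lift: "ramify2 m (?l ^ j * Q) = ?lL ^ j * ramify2 m Q" for j Q
  proof -
    have "ramify2 m (?l ^ j) = ?lL ^ j"
      using n by (induction j) (simp_all add: ramify2_mult ramify2_diff aL)
    then show ?thesis
      using n by (simp add: ramify2_mult)
  qed
  have FL: "ramify2 L F = ramify2 m (ramify2 n F)"
    using n by (simp add: L_def ramify2_ramify2)
  have "puiseux_at L F gs"
    using puiseux_at_mult[OF pui n(2)] by (simp add: L_def mult.commute)
  note count = puiseux_at_linear_power_dvd[OF this L a0]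
  have le: "j \<le> count_list gs a" if dvd: "?l ^ j dvd ramify2 n F" for j
  proof -
    obtain Q where "ramify2 n F = ?l ^ j * Q"
      using dvd by blast
    then have "ramify2 L F = ?lL ^ j * ramify2 m Q"
      by (simp only: FL lift)
    then show ?thesis
      using count by (metis dvd_triv_left)
  qed
  let ?S = "{j. ?l ^ j dvd ramify2 n F}"
  have fin: "finite ?S"
    by (rule finite_subset[of _ "{..count_list gs a}"]) (use le in auto)
  have "0 \<in> ?S"
    by simp
  then have "Max ?S \<in> ?S"
    using fin Max_in[of ?S] by blast
  then obtain Q where Q: "ramify2 n F = ?l ^ Max ?S * Q"
    by blast
  have "eval_x (ramify n a) Q \<noteq> 0"
  proof
    assume "eval_x (ramify n a) Q = 0"
    then obtain Q' where "Q = ?l * Q'"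
      using linear_factor_dvd_iff[OF zero] by blast
    then have "ramify2 n F = ?l ^ Suc (Max ?S) * Q'"
      using Q by (simp add: mult_ac)
    then have "Suc (Max ?S) \<in> ?S"
      by (metis (mono_tags, lifting) dvd_triv_left mem_Collect_eq)
    then show False
      using fin Max_ge Suc_n_not_le_n by blast
  qed
  then have "eval_x (ramify L a) (ramify2 m Q) \<noteq> 0"
    using n zero fps_compose_eq_0_iff[of "fps_X ^ m" "eval_x (ramify n a) Q"]
    by (simp add: aL eval_x_ramify2[symmetric])
  moreover have "ramify2 L F = ?lL ^ Max ?S * ramify2 m Q"
    by (simp only: FL Q[symmetric] lift[symmetric])
  ultimately have "?lL ^ j dvd ramify2 L F \<longleftrightarrow> j \<le> Max ?S" for j
    using linear_power_dvd_iff[OF zero] by simp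
  then have "Max ?S = count_list gs a"
    using count by (metis le_antisym order_refl)
  then show ?thesis
    by (simp add: root_mult_def Let_def n_def)
qed

section \<open>The chain rule and the Jacobian determinant\<close>

lemma eval_x_derivation:
  fixes D :: "'a::comm_ring_1 fps \<Rightarrow> 'a fps"
  assumes a0: "fps_nth a 0 = 0"
    and add: "\<And>x y. D (x + y) = D x + D y" and mult: "\<And>x y. D (x * y) = D x * y + x * D y"
  shows "D (eval_x a F) = eval_x a (Abs_fps (\<lambda>i. D (fps_nth F i))) + eval_x a (fps_deriv F) * D a"
proof -
  let ?e = "\<lambda>F. D (eval_x a F) - eval_x a (Abs_fps (\<lambda>i. D (fps_nth F i))) - eval_x a (fps_deriv F) * D a"
  have "?e F = 0"
  proof (rule contraction_zero[OF a0, of ?e])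
    fix F :: "'a fps fps"
    let ?G = "fps_shift (Suc 0) F"
    have 1: "D (eval_x a F) = D (fps_nth F 0) + (D a * eval_x a ?G + a * D (eval_x a ?G))"
      by (subst eval_x_unfold[OF a0]) (simp only: add mult)
    have 2: "eval_x a (Abs_fps (\<lambda>i. D (fps_nth F i))) =
        D (fps_nth F 0) + a * eval_x a (Abs_fps (\<lambda>i. D (fps_nth ?G i)))"
    proof -
      have "fps_shift (Suc 0) (Abs_fps (\<lambda>i. D (fps_nth F i))) = Abs_fps (\<lambda>i. D (fps_nth ?G i))"
        by (rule fps_ext) simp
      then show ?thesis
        by (subst eval_x_unfold[OF a0]) simp
    qed
    have "fps_deriv F = ?G + fps_X * fps_deriv ?G"
      by (subst fps_unfold[of F]) simp
    then have 3: "eval_x a (fps_deriv F) = eval_x a ?G + a * eval_x a (fps_deriv ?G)"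
      by (simp only: eval_x_add eval_x_X_mult[OF a0])
    show "?e F = a * ?e ?G"
      unfolding 1 2 3 by (simp add: algebra_simps)
  qed
  then show ?thesis
    by (simp add: algebra_simps)
qed

lemma eval_x_chain_rule:
  fixes F :: series2
  assumes "fps_nth a 0 = 0"
  shows "fps_deriv (eval_x a F) = eval_x a (deriv_y F) + eval_x a (deriv_x F) * fps_deriv a"
  using eval_x_derivation[OF assms, of fps_deriv F] by (simp add: deriv_y_def deriv_x_def)

lemma deriv_x_ramify2: "n > 0 \<Longrightarrow> deriv_x (ramify2 n F) = ramify2 n (deriv_x F)"
proof (rule fps_ext)
  fix i assume "n > 0"
  have "of_nat m oo fps_X ^ n = (of_nat m :: complex fps)" for m
    by (metis fps_const_compose fps_of_nat)
  from this[of "Suc i"] show "fps_nth (deriv_x (ramify2 n F)) i = fps_nth (ramify2 n (deriv_x F)) i"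
    using \<open>n > 0\<close> by (simp add: deriv_x_def fps_compose_mult_distrib del: of_nat_Suc)
qed

lemma deriv_y_ramify2:
  "n > 0 \<Longrightarrow> deriv_y (ramify2 n F) = fps_const (fps_deriv (fps_X ^ n)) * ramify2 n (deriv_y F)"
  by (rule fps_ext) (simp add: deriv_y_def fps_compose_deriv mult.commute del: fps_deriv_power)

lemma jacobian_ramify2:
  assumes "n > 0"
  shows "jacobian_det (ramify2 n f) (ramify2 n g) =
    fps_const (fps_deriv (fps_X ^ n)) * ramify2 n (jacobian_det f g)"
  unfolding jacobian_det_def deriv_x_ramify2[OF assms] deriv_y_ramify2[OF assms]
    ramify2_diff ramify2_mult[OF assms] by (simp only: algebra_simps)

text \<open>Along a root \<open>a\<close> of \<open>f\<close> the chain rule gives \<open>f\<^sub>y = - f\<^sub>x a'\<close>, hence \<open>J = - f\<^sub>x \<cdot> (g(a(y), y))'\<close> up to the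
factor from the ramification. Here \<open>f\<^sub>x\<close> is nonzero since the root is simple, and \<open>g\<close> along \<open>a\<close> is not
constant, since it vanishes at the origin but not identically.\<close>
lemma jacobian_nonzero_at_root:
  assumes f: "puiseux_at n f as" and g: "puiseux_at n g bs"
    and g0: "coeff2 g 0 0 = 0"
    and a: "a \<in> set as" "count_list as a = 1" "a \<notin> set bs"
  shows "eval_x (ramify n a) (ramify2 n (jacobian_det f g)) \<noteq> 0"
proof
  assume zero: "eval_x (ramify n a) (ramify2 n (jacobian_det f g)) = 0"
  define A where "A = ramify n a"
  have n: "n > 0" and den: "denominator n a" "a 0 = 0"
    using f a by (auto simp: puiseux_at_def)
  have A0: "fps_nth A 0 = 0"
    by (simp add: A_def den)
  define F G where "F = ramify2 n f" and "G = ramify2 n g"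
  have "eval_x A (jacobian_det F G) = 0"
    using zero A0 n by (simp add: F_def G_def A_def jacobian_ramify2 eval_x_mult)
  moreover have FA: "eval_x A F = 0"
    using puiseux_at_root_iff[OF f den] a by (simp add: A_def F_def)
  then have Fy: "eval_x A (deriv_y F) = - (eval_x A (deriv_x F) * fps_deriv A)"
    using eval_x_chain_rule[OF A0, of F] by (simp add: add_eq_0_iff)
  moreover have "eval_x A (jacobian_det F G) = - (eval_x A (deriv_x F) * fps_deriv (eval_x A G))"
    unfolding jacobian_det_def eval_x_diff eval_x_mult[OF A0] Fy eval_x_chain_rule[OF A0, of G]
    by (simp add: algebra_simps)
  ultimately have "eval_x A (deriv_x F) * fps_deriv (eval_x A G) = 0"
    by simp
  moreover have "eval_x A (deriv_x F) \<noteq> 0"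
  proof
    assume Fx: "eval_x A (deriv_x F) = 0"
    obtain Q where Q: "F = (fps_X - fps_const A) * Q"
      using FA linear_factor_dvd_iff[OF A0] by blast
    have "eval_x A Q = 0"
      using Fx A0 by (simp add: Q deriv_x_def eval_x_add eval_x_mult eval_x_diff)
    then obtain Q' where Q': "Q = (fps_X - fps_const A) * Q'"
      using linear_factor_dvd_iff[OF A0] by blast
    have "(fps_X - fps_const A) ^ 2 dvd F"
      using Q Q' by (simp add: power2_eq_square mult.assoc)
    then have "2 \<le> count_list as a"
      using puiseux_at_linear_power_dvd[OF f den] by (simp add: A_def F_def)
    then show False
      using a by simp
  qed
  ultimately have "fps_deriv (eval_x A G) = 0"
    by simp
  then have "eval_x A G = fps_const (fps_nth (eval_x A G) 0)"
    by (metis fps_deriv_eq_0_iff fps_nth_fps_const)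
  moreover have "fps_nth (eval_x A G) 0 = 0"
    using g0 n by (simp add: eval_x_nth_0 G_def coeff2_def)
  ultimately have "eval_x A G = 0"
    by simp
  then show False
    using puiseux_at_root_iff[OF g den] a by (simp add: A_def G_def)
qed

section \<open>Restriction to a disc of arcs\<close>

definition fps_poly :: "complex fps \<Rightarrow> complex poly fps" where
  "fps_poly c = Abs_fps (\<lambda>k. [:fps_nth c k:])"

lemma fps_poly_nth [simp]: "fps_nth (fps_poly c) k = [:fps_nth c k:]"
  by (simp add: fps_poly_def)

lemma fps_poly_add: "fps_poly (c + d) = fps_poly c + fps_poly d"
  by (rule fps_ext) simp

lemma fps_poly_diff: "fps_poly (c - d) = fps_poly c - fps_poly d"
  by (rule fps_ext) simp

lemma sum_const_poly: "(\<Sum>i\<in>A. [:f i:]) = [:\<Sum>i\<in>A. f i:]"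
  by (induction A rule: infinite_finite_induct) auto

lemma fps_poly_mult: "fps_poly (c * d) = fps_poly c * fps_poly d"
  by (rule fps_ext) (simp add: fps_mult_nth sum_const_poly mult.commute)

lemma fps_poly_X_power [simp]: "fps_poly (fps_X ^ k) = fps_X ^ k"
  by (rule fps_ext) (simp add: fps_X_power_nth one_pCons)

definition disc_arc :: "complex fps \<Rightarrow> nat \<Rightarrow> complex poly fps" where
  "disc_arc l H = fps_poly l + fps_const [:0, 1:] * fps_X ^ H"

text \<open>The series \<open>F(l(t) + z t\<^sup>H, t)\<close> with an indeterminate \<open>z\<close>. When \<open>H\<close> and the order of \<open>l\<close> are positive,
only finitely many powers of \<open>z\<close> meet each power of \<open>t\<close>, so that polynomials in \<open>z\<close> suffice as
coefficients.\<close>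
definition disc :: "complex fps \<Rightarrow> nat \<Rightarrow> series2 \<Rightarrow> complex poly fps" where
  "disc l H F = eval_x (disc_arc l H) (Abs_fps (\<lambda>i. fps_poly (fps_nth F i)))"

lemma disc_arc_0: "fps_nth l 0 = 0 \<Longrightarrow> H > 0 \<Longrightarrow> fps_nth (disc_arc l H) 0 = 0"
  by (simp add: disc_arc_def)

lemma disc_diff: "disc l H (F - G) = disc l H F - disc l H G"
proof -
  have "Abs_fps (\<lambda>i. fps_poly (fps_nth (F - G) i)) =
      Abs_fps (\<lambda>i. fps_poly (fps_nth F i)) - Abs_fps (\<lambda>i. fps_poly (fps_nth G i))"
    by (rule fps_ext) (simp add: fps_poly_diff)
  then show ?thesis
    by (simp add: disc_def eval_x_diff)
qed

lemma disc_mult: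
  assumes "fps_nth l 0 = 0" "H > 0"
  shows "disc l H (F * G) = disc l H F * disc l H G"
proof -
  have sum: "fps_poly (\<Sum>i\<in>A. c i) = (\<Sum>i\<in>A. fps_poly (c i))" for A :: "nat set" and c
    by (induction A rule: infinite_finite_induct) (auto simp: fps_poly_add fps_eq_iff)
  have "Abs_fps (\<lambda>i. fps_poly (fps_nth (F * G) i)) =
      Abs_fps (\<lambda>i. fps_poly (fps_nth F i)) * Abs_fps (\<lambda>i. fps_poly (fps_nth G i))"
    by (rule fps_ext) (simp add: fps_mult_nth sum fps_poly_mult)
  then show ?thesis
    by (simp add: disc_def eval_x_mult[OF disc_arc_0[OF assms]])
qed

lemma disc_const [simp]: "disc l H (fps_const c) = fps_poly c"
proof -
  have "Abs_fps (\<lambda>i. fps_poly (fps_nth (fps_const c) i)) = fps_const (fps_poly c)"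
    by (rule fps_ext) (auto simp: fps_nth_fps_const fps_eq_iff)
  then show ?thesis
    by (simp add: disc_def)
qed

lemma disc_X: "fps_nth l 0 = 0 \<Longrightarrow> H > 0 \<Longrightarrow> disc l H fps_X = disc_arc l H"
proof -
  assume "fps_nth l 0 = 0" "H > 0"
  moreover have "Abs_fps (\<lambda>i. fps_poly (fps_nth fps_X i)) = fps_X"
    by (rule fps_ext) (auto simp: fps_eq_iff fps_X_def one_pCons)
  ultimately show ?thesis
    by (simp add: disc_def disc_arc_0)
qed

lemma disc_nth_0: "fps_nth (disc l H F) 0 = [:fps_nth (fps_nth F 0) 0:]"
  by (simp add: disc_def eval_x_nth_0)

definition at_z :: "complex \<Rightarrow> complex poly fps \<Rightarrow> complex fps" where
  "at_z z A = Abs_fps (\<lambda>k. poly (fps_nth A k) z)"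

lemma at_z_disc:
  assumes "fps_nth l 0 = 0" "H > 0"
  shows "at_z z (disc l H F) = eval_x (l + fps_const z * fps_X ^ H) F"
proof -
  have add: "at_z z (x + y) = at_z z x + at_z z y" for x y
    by (rule fps_ext) (simp add: at_z_def)
  have mult: "at_z z (x * y) = at_z z x * at_z z y" for x y
    by (rule fps_ext) (simp add: at_z_def fps_mult_nth poly_sum)
  have poly: "at_z z (fps_poly c) = c" for c
    by (rule fps_ext) (simp add: at_z_def)
  have arc: "at_z z (disc_arc l H) = l + fps_const z * fps_X ^ H"
    by (rule fps_ext) (simp add: at_z_def disc_arc_def fps_X_power_nth)
  have "at_z z (disc l H F) = eval_x (at_z z (disc_arc l H))
      (Abs_fps (\<lambda>i. at_z z (fps_nth (Abs_fps (\<lambda>i. fps_poly (fps_nth F i))) i)))"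
    unfolding disc_def by (rule eval_x_hom) (use assms in \<open>simp_all add: disc_arc_0 arc add mult\<close>)
  then show ?thesis
    by (simp add: arc poly fps_nth_inverse)
qed

definition deriv_z :: "complex poly fps \<Rightarrow> complex poly fps" where
  "deriv_z A = Abs_fps (\<lambda>k. pderiv (fps_nth A k))"

text \<open>For \<open>x = l(t) + z t\<^sup>H\<close> the derivatives with respect to \<open>z\<close> and \<open>t\<close> are \<open>F\<^sub>x t\<^sup>H\<close> and
\<open>F\<^sub>t + F\<^sub>x \<partial>\<^sub>t x\<close>; the terms with \<open>\<partial>\<^sub>t x\<close> cancel in the determinant.\<close>
lemma disc_jacobian:
  assumes l: "fps_nth l 0 = 0" "H > 0"
  shows "fps_deriv (disc l H F) * deriv_z (disc l H G) - deriv_z (disc l H F) * fps_deriv (disc l H G) =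
    fps_X ^ H * disc l H (jacobian_det F G)"
proof -
  note arc = disc_arc_0[OF l]
  have add: "deriv_z (x + y) = deriv_z x + deriv_z y" for x y
    by (rule fps_ext) (simp add: deriv_z_def pderiv_add)
  have mult: "deriv_z (x * y) = deriv_z x * y + x * deriv_z y" for x y
    by (rule fps_ext, simp add: deriv_z_def fps_mult_nth higher_pderiv_sum[of 1, simplified])
       (simp add: pderiv_mult sum.distrib algebra_simps)
  have const: "deriv_z (fps_poly c) = 0" for c
    by (rule fps_ext) (simp add: deriv_z_def pderiv_pCons)
  have arc_z: "deriv_z (disc_arc l H) = fps_X ^ H"
    by (rule fps_ext) (simp add: deriv_z_def disc_arc_def pderiv_add pderiv_pCons fps_X_power_nth one_pCons)
  have dx: "fps_deriv (Abs_fps (\<lambda>i. fps_poly (fps_nth F i))) =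
      Abs_fps (\<lambda>i. fps_poly (fps_nth (deriv_x F) i))" for F
    by (intro fps_ext)
       (simp add: deriv_x_def fps_mult_left_const_nth of_nat_poly flip: fps_of_nat del: of_nat_Suc)
  have dy: "Abs_fps (\<lambda>i. fps_deriv (fps_nth (Abs_fps (\<lambda>i. fps_poly (fps_nth F i))) i)) =
      Abs_fps (\<lambda>i. fps_poly (fps_nth (deriv_y F) i))" for F
    by (intro fps_ext) (simp add: deriv_y_def of_nat_poly del: of_nat_Suc)
  have z: "deriv_z (disc l H F) = disc l H (deriv_x F) * fps_X ^ H" for F
  proof -
    have "Abs_fps (\<lambda>i. deriv_z (fps_nth (Abs_fps (\<lambda>i. fps_poly (fps_nth F i))) i)) = 0"
      by (rule fps_ext) (simp add: const)
    then show ?thesis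
      unfolding disc_def by (subst eval_x_derivation[OF arc add mult]) (simp add: dx arc_z)
  qed
  have t: "fps_deriv (disc l H F) = disc l H (deriv_y F) + disc l H (deriv_x F) * fps_deriv (disc_arc l H)" for F
    unfolding disc_def by (subst eval_x_derivation[OF arc, where D = fps_deriv], simp, simp, simp only: dx dy)
  show ?thesis
    by (simp add: z t jacobian_det_def disc_diff disc_mult[OF l] algebra_simps)
qed

section \<open>Lowest coefficients\<close>

definition lead :: "complex poly fps \<Rightarrow> complex poly" where
  "lead A = fps_nth A (subdegree A)"

lemma lead_mult: "lead (A * B) = lead A * lead B"
  by (cases "A = 0 \<or> B = 0") (auto simp: lead_def)

lemma leadI:
  assumes "\<And>j. j < k \<Longrightarrow> fps_nth A j = 0" and "fps_nth A k \<noteq> 0"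
  shows "lead A = fps_nth A k" and "subdegree A = k"
proof -
  show "subdegree A = k"
    by (rule subdegreeI) (use assms in auto)
  then show "lead A = fps_nth A k"
    by (simp add: lead_def)
qed

lemma fps_mult_nth_low:
  fixes A B :: "'a::comm_ring_1 fps"
  assumes A: "\<And>j. j < m \<Longrightarrow> fps_nth A j = 0" and B: "\<And>j. j < k \<Longrightarrow> fps_nth B j = 0"
  shows "fps_nth (A * B) (m + k) = fps_nth A m * fps_nth B k"
    and "j < m + k \<Longrightarrow> fps_nth (A * B) j = 0"
proof -
  have A': "A = fps_X ^ m * fps_shift m A"
    by (rule fps_ext) (auto simp: fps_X_power_mult_nth A)
  have B': "B = fps_X ^ k * fps_shift k B"
    by (rule fps_ext) (auto simp: fps_X_power_mult_nth B)
  have AB: "A * B = fps_X ^ (m + k) * (fps_shift m A * fps_shift k B)"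
    by (subst A', subst B') (simp only: power_add mult_ac)
  show "fps_nth (A * B) (m + k) = fps_nth A m * fps_nth B k"
    and "j < m + k \<Longrightarrow> fps_nth (A * B) j = 0"
    unfolding AB fps_X_power_mult_nth by simp_all
qed

text \<open>In lowest order \<open>t \<partial>\<^sub>t\<close> multiplies by the exponent and \<open>\<partial>\<^sub>z\<close> differentiates the lowest coefficient.
The factor \<open>t\<close> avoids a negative exponent when one of the two series has order zero.\<close>
lemma lead_wronskian:
  fixes A B :: "complex poly fps"
  defines "K \<equiv> of_nat (subdegree A) * (lead A * pderiv (lead B)) -
      of_nat (subdegree B) * (pderiv (lead A) * lead B)"
  assumes "K \<noteq> 0"
  shows "lead (fps_X * (fps_deriv A * deriv_z B - deriv_z A * fps_deriv B)) = K"
proof -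
  let ?W = "(fps_X * fps_deriv A) * deriv_z B - deriv_z A * (fps_X * fps_deriv B)"
  have low: "fps_nth (fps_X * fps_deriv C) j = 0" "fps_nth (deriv_z C) j = 0" if "j < subdegree C" for C j
    using that by (simp_all add: deriv_z_def nth_less_subdegree_zero)
  have top: "fps_nth (fps_X * fps_deriv C) (subdegree C) = of_nat (subdegree C) * lead C"
    "fps_nth (deriv_z C) (subdegree C) = pderiv (lead C)" for C
    by (simp_all add: deriv_z_def lead_def)
  have "fps_nth ?W j = 0" if "j < subdegree A + subdegree B" for j
    using fps_mult_nth_low(2)[OF low(1) low(2) that] fps_mult_nth_low(2)[OF low(2) low(1) that] by simp
  moreover have "fps_nth ?W (subdegree A + subdegree B) = K"
    using fps_mult_nth_low(1)[of "subdegree A" "fps_X * fps_deriv A" "subdegree B" "deriv_z B", OF low]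
      fps_mult_nth_low(1)[of "subdegree A" "deriv_z A" "subdegree B" "fps_X * fps_deriv B", OF low(2) low(1)]
    unfolding fps_sub_nth top K_def by (simp only: mult_ac)
  ultimately have "lead ?W = K"
    using leadI(1)[of "subdegree A + subdegree B" ?W] assms(2) by simp
  then show ?thesis
    by (simp add: algebra_simps)
qed

definition near :: "fracseries \<Rightarrow> real \<Rightarrow> fracseries \<Rightarrow> bool" where
  "near c h a \<longleftrightarrow> (\<forall>e<h. a e = c e)"

lemma lead_disc_linear:
  assumes c: "denominator n c" "c 0 = 0" "\<And>e. h \<le> e \<Longrightarrow> c e = 0"
    and a: "denominator n a" and h: "h = real H / real n" "H > 0"
  defines "A \<equiv> lead (disc (ramify n c) H (fps_X - fps_const (ramify n a)))"
  shows "near c h a \<Longrightarrow> A = [:- a h, 1:]"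
    and "\<not> near c h a \<Longrightarrow> \<exists>k. k \<noteq> 0 \<and> A = [:k:]"
proof -
  have n: "n > 0"
    using a by (simp add: denominator_def)
  have "disc (ramify n c) H (fps_X - fps_const (ramify n a)) =
      disc_arc (ramify n c) H - fps_poly (ramify n a)"
    by (simp add: disc_diff disc_X c h)
  then have nth: "fps_nth (disc (ramify n c) H (fps_X - fps_const (ramify n a))) k =
      [:c (real k / real n) - a (real k / real n):] + (if k = H then [:0, 1:] else 0)" for k
    by (simp add: disc_arc_def fps_X_power_nth)
  have less: "real k / real n < h \<longleftrightarrow> k < H" for k
    using n by (simp add: h divide_less_cancel)
  have grid: "near c h a \<longleftrightarrow> (\<forall>k<H. a (real k / real n) = c (real k / real n))"
  proof
    assume *: "\<forall>k<H. a (real k / real n) = c (real k / real n)"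
    show "near c h a"
      unfolding near_def
    proof (intro allI impI)
      fix e assume "e < h"
      show "a e = c e"
      proof (cases "\<exists>k::nat. e = real k / real n")
        case True
        then show ?thesis
          using * \<open>e < h\<close> less by blast
      next
        case False
        then show ?thesis
          using a c(1) unfolding denominator_def by metis
      qed
    qed
  qed (simp add: near_def less)
  show "A = [:- a h, 1:]" if "near c h a"
    unfolding A_def by (subst leadI(1)[of H]) (use that c(3)[of h] in \<open>simp_all add: nth grid flip: h(1)\<close>)
  show "\<exists>k. k \<noteq> 0 \<and> A = [:k:]" if "\<not> near c h a"
  proof -
    let ?P = "\<lambda>k. k < H \<and> a (real k / real n) \<noteq> c (real k / real n)"
    define m where "m = (LEAST k. ?P k)"
    have m: "?P m"
      unfolding m_def by (rule LeastI_ex) (use that grid in blast)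
    have below: "a (real k / real n) = c (real k / real n)" if "k < m" for k
      using not_less_Least[OF that[unfolded m_def]] m that by linarith
    have "c (real m / real n) - a (real m / real n) \<noteq> 0"
      using m by (metis right_minus_eq)
    then have "A = [:c (real m / real n) - a (real m / real n):]"
      unfolding A_def by (subst leadI(1)[of m]) (use m below in \<open>simp_all add: nth\<close>)
    then show ?thesis
      using m by auto
  qed
qed

text \<open>A root inside the disc contributes a linear factor and any other root only a nonzero constant, so
the lowest coefficient records how many roots lie in the disc and where they climb.\<close>
lemma lead_disc:
  assumes F: "puiseux_at n F rs"
    and c: "denominator n c" "c 0 = 0" "\<And>e. h \<le> e \<Longrightarrow> c e = 0" and h: "h = real H / real n" "H > 0"
  shows "\<exists>k. k \<noteq> 0 \<and> lead (disc (ramify n c) H (ramify2 n F)) =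
    smult k (\<Prod>a\<leftarrow>filter (near c h) rs. [:- a h, 1:])"
proof -
  obtain V M where rs: "\<forall>a\<in>set rs. denominator n a"
    and V: "fps_nth (fps_nth V 0) 0 \<noteq> 0"
    and F: "ramify2 n F = V * fps_const (fps_X ^ M) * (\<Prod>a\<leftarrow>rs. fps_X - fps_const (ramify n a))"
    using F unfolding puiseux_at_def by auto
  let ?d = "disc (ramify n c) H"
  have l: "fps_nth (ramify n c) 0 = 0"
    by (simp add: c)
  have 1: "lead (?d V) = [:fps_nth (fps_nth V 0) 0:]"
    using leadI(1)[of 0 "?d V"] V by (simp add: disc_nth_0)
  have 2: "lead (fps_X ^ M) = 1"
    using leadI(1)[of M "fps_X ^ M"] by (simp add: fps_X_power_nth)
  have 3: "\<exists>k. k \<noteq> 0 \<and> lead (?d (\<Prod>a\<leftarrow>rs. fps_X - fps_const (ramify n a))) =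
      smult k (\<Prod>a\<leftarrow>filter (near c h) rs. [:- a h, 1:])"
    using rs
  proof (induction rs)
    case Nil
    have "lead (?d 1) = 1"
      using leadI(1)[of 0 "?d 1"] by (simp add: disc_nth_0 one_pCons)
    then show ?case
      by (intro exI[of _ 1]) simp
  next
    case (Cons a rs)
    then obtain k where k: "k \<noteq> 0" "lead (?d (\<Prod>a\<leftarrow>rs. fps_X - fps_const (ramify n a))) =
        smult k (\<Prod>a\<leftarrow>filter (near c h) rs. [:- a h, 1:])"
      by auto
    have a: "denominator n a"
      using Cons.prems by simp
    show ?case
    proof (cases "near c h a")
      case True
      then show ?thesis
        using k lead_disc_linear(1)[OF c a h True]
        by (intro exI[of _ k]) (simp add: disc_mult[OF l h(2)] lead_mult)
    next
      case False
      then obtain k' where "k' \<noteq> 0" "lead (?d (fps_X - fps_const (ramify n a))) = [:k':]"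
        using lead_disc_linear(2)[OF c a h False] by blast
      then show ?thesis
        using k False by (intro exI[of _ "k * k'"]) (simp add: disc_mult[OF l h(2)] lead_mult)
    qed
  qed
  then obtain k where "k \<noteq> 0" "lead (?d (\<Prod>a\<leftarrow>rs. fps_X - fps_const (ramify n a))) =
      smult k (\<Prod>a\<leftarrow>filter (near c h) rs. [:- a h, 1:])"
    by blast
  then show ?thesis
    using V by (intro exI[of _ "fps_nth (fps_nth V 0) 0 * k"])
      (simp add: F disc_mult[OF l h(2)] lead_mult 1 2 mult.commute)
qed

section \<open>Zeros of the rational function of a bar\<close>

lemma order_mult_power:
  fixes p :: "complex poly"
  assumes "poly q z \<noteq> 0"
  shows "order z ([:- z, 1:] ^ k * q) = k"
proof -
  have "q \<noteq> 0"
    using assms by auto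
  then have "order z ([:- z, 1:] ^ k * q) = order z ([:- z, 1:] ^ k) + order z q"
    by (intro order_mult) auto
  then show ?thesis
    using assms by (simp add: order_power_n_n order_0I)
qed

text \<open>Let \<open>L\<close> be the monic linear polynomial that vanishes at \<open>z\<close>. With \<open>F = L\<^sup>p F\<^sub>1\<close> and \<open>G = L\<^sup>q G\<^sub>1\<close> one has
\<open>L K = L\<^sup>p\<^sup>+\<^sup>q (\<Delta> F\<^sub>1 G\<^sub>1 + L X)\<close> for a polynomial \<open>X\<close>, from which both claims can be read off. The
multiplication by \<open>L\<close> covers the cases \<open>p = 0\<close> and \<open>q = 0\<close> too.\<close>
lemma order_wronskian:
  fixes F G :: "complex poly" and \<mu> \<kappa> z :: complex
  assumes "F \<noteq> 0" "G \<noteq> 0"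
  defines "K \<equiv> smult \<mu> (F * pderiv G) - smult \<kappa> (pderiv F * G)"
    and "\<Delta> \<equiv> \<mu> * of_nat (order z G) - \<kappa> * of_nat (order z F)"
  shows "\<Delta> \<noteq> 0 \<Longrightarrow> K \<noteq> 0 \<and> Suc (order z K) = order z (F * G)"
    and "\<Delta> = 0 \<Longrightarrow> K \<noteq> 0 \<Longrightarrow> order z (F * G) \<le> order z K"
proof -
  define L where "L = [:- z, 1:]"
  have pderiv_L: "pderiv L = 1" and "L \<noteq> 0" and "poly L z = 0"
    by (simp_all add: L_def pderiv_pCons one_pCons)
  define p q where "p = order z F" and "q = order z G"
  obtain F1 where F1: "F = L ^ p * F1" "poly F1 z \<noteq> 0"
    using order_decomp[OF assms(1), of z] by (auto simp: p_def L_def poly_eq_0_iff_dvd)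
  obtain G1 where G1: "G = L ^ q * G1" "poly G1 z \<noteq> 0"
    using order_decomp[OF assms(2), of z] by (auto simp: q_def L_def poly_eq_0_iff_dvd)
  have deriv: "L * pderiv (L ^ k * P) = L ^ k * (of_nat k * P + L * pderiv P)" for k and P :: "complex poly"
  proof (cases k)
    case (Suc j)
    have "pderiv (L ^ Suc j) = of_nat (Suc j) * L ^ j"
      by (simp add: pderiv_power_Suc pderiv_L of_nat_poly del: power_Suc)
    then show ?thesis
      unfolding Suc pderiv_mult by (simp only: power_Suc) (simp only: algebra_simps)
  qed simp
  define X where "X = smult \<mu> (F1 * pderiv G1) - smult \<kappa> (pderiv F1 * G1)"
  have of_nat: "of_nat k * P = smult (of_nat k) P" for k and P :: "complex poly"
    by (simp add: of_nat_poly)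
  have "L * K = smult \<mu> (F * (L * pderiv G)) - smult \<kappa> ((L * pderiv F) * G)"
    by (simp add: K_def algebra_simps)
  also have "\<dots> = smult \<mu> ((L ^ p * F1) * (L ^ q * (of_nat q * G1 + L * pderiv G1))) -
      smult \<kappa> (L ^ p * (of_nat p * F1 + L * pderiv F1) * (L ^ q * G1))"
    by (subst (1 2) F1(1), subst (1 2) G1(1)) (simp only: deriv)
  also have "\<dots> = L ^ (p + q) * (smult \<Delta> (F1 * G1) + L * X)"
    unfolding of_nat \<Delta>_def p_def[symmetric] q_def[symmetric] X_def power_add
    by (simp add: algebra_simps smult_add_left smult_diff_left smult_add_right smult_diff_right)
  finally have LK: "L * K = L ^ (p + q) * (smult \<Delta> (F1 * G1) + L * X)" .
  have order_FG: "order z (F * G) = p + q"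
    using assms by (simp add: order_mult p_def q_def)
  have order_LK: "order z (L * K) = Suc (order z K)" if "K \<noteq> 0"
    using that order_mult[of L K z] order_power_n_n[of z 1] \<open>L \<noteq> 0\<close> by (simp add: L_def del: mult_pCons_left)
  show "K \<noteq> 0 \<and> Suc (order z K) = order z (F * G)" if "\<Delta> \<noteq> 0"
  proof -
    have *: "poly (smult \<Delta> (F1 * G1) + L * X) z \<noteq> 0"
      using that F1(2) G1(2) \<open>poly L z = 0\<close> by simp
    then have "L ^ (p + q) * (smult \<Delta> (F1 * G1) + L * X) \<noteq> 0"
      using \<open>L \<noteq> 0\<close> by (metis mult_eq_0_iff poly_0 power_not_zero)
    then have "K \<noteq> 0"
      using LK by auto
    moreover have "order z (L * K) = p + q"
      unfolding LK using order_mult_power[OF *] by (simp only: L_def)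
    ultimately show ?thesis
      using order_LK order_FG by simp
  qed
  show "order z (F * G) \<le> order z K" if "\<Delta> = 0" "K \<noteq> 0"
  proof -
    have "L * K = L * (L ^ (p + q) * X)"
      using LK that(1) by (simp add: algebra_simps)
    then have "K = L ^ (p + q) * X"
      using \<open>L \<noteq> 0\<close> by simp
    then have "L ^ (p + q) dvd K"
      by simp
    then show ?thesis
      using order_FG order_divides[of z "p + q" K] that(2) by (simp add: L_def)
  qed
qed

lemma zorder_poly_quotient:
  fixes K D :: "complex poly"
  assumes "K \<noteq> 0" "D \<noteq> 0" and M: "\<forall>\<^sub>F w in at z. M w = poly K w / poly D w"
  shows "zorder M z = int (order z K) - int (order z D)"
proof -
  define k d where "k = order z K" and "d = order z D"
  obtain K1 where K1: "K = [:- z, 1:] ^ k * K1" "poly K1 z \<noteq> 0"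
    using order_decomp[OF assms(1), of z] by (auto simp: k_def poly_eq_0_iff_dvd)
  obtain D1 where D1: "D = [:- z, 1:] ^ d * D1" "poly D1 z \<noteq> 0"
    using order_decomp[OF assms(2), of z] by (auto simp: d_def poly_eq_0_iff_dvd)
  have "zorder M z = zorder (\<lambda>w. poly K w / poly D w) z"
    by (rule zorder_cong) (use M in auto)
  also have "\<dots> = int k - int d"
  proof (rule zorder_eqI[where S = "{w. poly D1 w \<noteq> 0}" and g = "\<lambda>w. poly K1 w / poly D1 w"])
    show "open {w. poly D1 w \<noteq> 0}"
      by (intro open_Collect_neq continuous_intros)
    show "poly K w / poly D w = poly K1 w / poly D1 w * (w - z) powi (int k - int d)"
      if "w \<noteq> z" for w
      using that by (simp add: K1(1) D1(1) power_int_diff mult.commute)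
  qed (use K1 D1 in \<open>auto intro!: holomorphic_intros\<close>)
  finally show ?thesis
    by (simp add: k_def d_def)
qed

lemma degree_eq_sum_order:
  fixes p :: "complex poly"
  assumes "p \<noteq> 0" "finite Z" "\<And>z. poly p z = 0 \<Longrightarrow> z \<in> Z"
  shows "degree p = (\<Sum>z\<in>Z. order z p)"
proof -
  have "degree p = degree (\<Prod>z|poly p z = 0. [:-z, 1:] ^ order z p)"
    by (subst complex_poly_decompose[of p, symmetric], subst degree_smult_eq) (use assms(1) in auto)
  also have "\<dots> = (\<Sum>z|poly p z = 0. degree ([:-z, 1:] ^ order z p))"
    by (rule degree_prod_eq_sum_degree) auto
  also have "\<dots> = (\<Sum>z|poly p z = 0. order z p)"
    by (simp add: degree_linear_power)
  also have "\<dots> = (\<Sum>z\<in>Z. order z p)"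
    by (rule sum.mono_neutral_left) (use assms order_root in auto)
  finally show ?thesis .
qed

lemma log_derivative:
  fixes F :: "complex poly"
  assumes "F = smult k (\<Prod>a\<leftarrow>as. [:- r a, 1:])" and "k \<noteq> 0" "poly F z \<noteq> 0"
  shows "poly (pderiv F) z / poly F z = (\<Sum>a\<leftarrow>as. 1 / (z - r a))"
proof -
  have "poly (pderiv (\<Prod>a\<leftarrow>as. [:- r a, 1:])) z =
      poly (\<Prod>a\<leftarrow>as. [:- r a, 1:]) z * (\<Sum>a\<leftarrow>as. 1 / (z - r a))"
    if "poly (\<Prod>a\<leftarrow>as. [:- r a, 1:]) z \<noteq> 0"
    using that
  proof (induction as)
    case (Cons a as)
    let ?P = "\<Prod>a\<leftarrow>as. [:- r a, 1:]"
    have nz: "z - r a \<noteq> 0" "poly ?P z \<noteq> 0"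
      using Cons.prems by auto
    have "poly (pderiv ([:- r a, 1:] * ?P)) z = (z - r a) * poly (pderiv ?P) z + poly ?P z"
      unfolding pderiv_mult by (simp add: pderiv_pCons del: mult_pCons_left)
    also have "\<dots> = (z - r a) * poly ?P z * (1 / (z - r a) + (\<Sum>a\<leftarrow>as. 1 / (z - r a)))"
      using nz Cons.IH[OF nz(2)] by (simp add: distrib_left)
    finally show ?case
      by (simp add: left_diff_distrib)
  qed simp
  then show ?thesis
    using assms by (simp add: pderiv_smult)
qed

lemma order_prod_linear:
  fixes r :: "'b \<Rightarrow> complex"
  shows "order z (\<Prod>a\<leftarrow>as. [:- r a, 1:]) = length (filter (\<lambda>a. r a = z) as)"
    and "degree (\<Prod>a\<leftarrow>as. [:- r a, 1:]) = length as"
    and "(\<Prod>a\<leftarrow>as. [:- r a, 1:]) \<noteq> 0"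
proof -
  show nz: "(\<Prod>a\<leftarrow>as. [:- r a, 1:]) \<noteq> 0" for as
    by (auto simp: prod_list_zero_iff)
  show "order z (\<Prod>a\<leftarrow>as. [:- r a, 1:]) = length (filter (\<lambda>a. r a = z) as)"
  proof (induction as)
    case (Cons a as)
    have "order z [:- r a, 1:] = (if r a = z then 1 else 0)"
      using order_power_n_n[of z 1] by (auto intro: order_0I)
    then show ?case
      using Cons nz[of "a # as"] by (simp add: order_mult del: mult_pCons_left)
  qed (simp add: order_0I)
  show "degree (\<Prod>a\<leftarrow>as. [:- r a, 1:]) = length as"
    by (induction as) (use nz in \<open>simp_all add: degree_mult_eq del: mult_pCons_left\<close>)
qed


text \<open>Outside the zeros of \<open>F G\<close> the function \<open>M\<close> is the quotient \<open>K / (F G)\<close>, so its order at a point is the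
difference of the orders of \<open>K\<close> and \<open>F G\<close>. It is \<open>-1\<close> at the points with \<open>\<Delta> \<noteq> 0\<close> and nonnegative at all
others; the function \<open>nat\<close> discards exactly the poles. Summing over all points turns orders into
degrees.\<close>
lemma wronskian_zero_count:
  fixes F G :: "complex poly" and \<mu> \<kappa> :: complex
  assumes FG: "F \<noteq> 0" "G \<noteq> 0"
  defines "K \<equiv> smult \<mu> (F * pderiv G) - smult \<kappa> (pderiv F * G)"
    and "\<Delta> \<equiv> \<lambda>z. \<mu> * of_nat (order z G) - \<kappa> * of_nat (order z F)"
  assumes K: "K \<noteq> 0"
    and M: "\<And>z. poly F z \<noteq> 0 \<Longrightarrow> poly G z \<noteq> 0 \<Longrightarrow> M z = poly K z / poly (F * G) z"
  shows "\<Delta> c = 0 \<Longrightarrow> order c K = order c F + order c G + nat (zorder M c)"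
    and "degree K + card {z. \<Delta> z \<noteq> 0} =
      degree F + degree G + (\<Sum>z\<in>{z. nat (zorder M z) \<noteq> 0}. nat (zorder M z))"
proof -
  note order = order_wronskian[OF FG, where \<mu> = \<mu> and \<kappa> = \<kappa>, folded K_def]
  have FG0: "F * G \<noteq> 0"
    using FG by simp
  have fin: "finite {z. poly (F * G) z = 0}"
    using poly_roots_finite[OF FG0] .
  have zorder: "zorder M z = int (order z K) - int (order z (F * G))" for z
  proof (rule zorder_poly_quotient[OF K FG0])
    have "\<forall>\<^sub>F w in at z. w \<notin> {z. poly (F * G) z = 0}"
      using fin by (metis Compl_iff eventually_at_topological eventually_mono finite_imp_closed insertCI
          islimpt_finite islimpt_iff_eventually)
    then show "\<forall>\<^sub>F w in at z. M w = poly K w / poly (F * G) w"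
      by eventually_elim (use M in auto)
  qed
  have balance: "order z K + (if \<Delta> z \<noteq> 0 then 1 else 0) = order z F + order z G + nat (zorder M z)" for z
    using order[where z = z] K order_mult[OF FG0, of z] by (auto simp: zorder \<Delta>_def)
  then show "\<Delta> c = 0 \<Longrightarrow> order c K = order c F + order c G + nat (zorder M c)"
    by (metis add.right_neutral)
  define Z where "Z = {z. poly (F * G) z = 0} \<union> {z. poly K z = 0}"
  have finZ: "finite Z"
    using fin poly_roots_finite[OF K] by (simp add: Z_def)
  have out: "order z K = 0" "order z F = 0" "order z G = 0" if "z \<notin> Z" for z
    using that by (auto simp: Z_def intro: order_0I)
  have "{z. \<Delta> z \<noteq> 0} \<subseteq> Z"
    using out unfolding \<Delta>_def by force
  moreover have "{z. nat (zorder M z) \<noteq> 0} \<subseteq> Z"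
  proof (rule subsetI, rule ccontr)
    fix z assume z: "z \<in> {z. nat (zorder M z) \<noteq> 0}" "z \<notin> Z"
    then have "\<Delta> z = 0"
      using out[of z] by (simp add: \<Delta>_def)
    then show False
      using balance[of z] out[OF z(2)] z(1) by simp
  qed
  ultimately have "(\<Sum>z\<in>Z. if \<Delta> z \<noteq> 0 then 1 else 0) = card {z. \<Delta> z \<noteq> 0}"
    "(\<Sum>z\<in>Z. nat (zorder M z)) = (\<Sum>z\<in>{z. nat (zorder M z) \<noteq> 0}. nat (zorder M z))"
    using finZ by (simp_all add: sum.If_cases Int_absorb1 Collect_conj_eq sum.mono_neutral_right)
  moreover have "degree K = (\<Sum>z\<in>Z. order z K)" "degree F = (\<Sum>z\<in>Z. order z F)" "degree G = (\<Sum>z\<in>Z. order z G)"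
    using K FG finZ by (intro degree_eq_sum_order; force simp: Z_def)+
  moreover have "(\<Sum>z\<in>Z. order z K) + (\<Sum>z\<in>Z. if \<Delta> z \<noteq> 0 then 1 else 0) =
      (\<Sum>z\<in>Z. order z F) + (\<Sum>z\<in>Z. order z G) + (\<Sum>z\<in>Z. nat (zorder M z))"
    unfolding sum.distrib[symmetric] balance ..
  ultimately show "degree K + card {z. \<Delta> z \<noteq> 0} =
      degree F + degree G + (\<Sum>z\<in>{z. nat (zorder M z) \<noteq> 0}. nat (zorder M z))"
    by simp
qed

section \<open>Contact orders\<close>

lemma contact_ge_iff: "contact a b \<ge> ereal h \<longleftrightarrow> (\<forall>e<h. a e = b e)"
proof -
  have "contact a b \<ge> ereal h \<longleftrightarrow> (\<forall>e. a e \<noteq> b e \<longrightarrow> h \<le> e)"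
    by (auto simp: contact_def ord_y_def le_INF_iff)
  then show ?thesis
    by (metis linorder_not_le)
qed

lemma contact_attained:
  assumes "denominator n a" "denominator n b" "a \<noteq> b"
  shows "\<exists>k::nat. contact a b = ereal (real k / real n) \<and> a (real k / real n) \<noteq> b (real k / real n)"
proof -
  let ?S = "ramify n a - ramify n b"
  have n: "n > 0"
    using assms by (simp add: denominator_def)
  have diff: "(\<lambda>e. a e - b e) = unramify n ?S"
  proof
    fix e
    show "a e - b e = unramify n ?S e"
    proof (cases "\<exists>k::nat. e = real k / real n")
      case True
      then show ?thesis
        using unramify_nth[OF n, of ?S] by auto
    next
      case False
      then show ?thesis
        using assms(1,2) denominator_unramify[OF n, of ?S] unfolding denominator_def by (metis diff_self)
    qed
  qed
  have "?S \<noteq> 0"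
    using ramify_inject[OF assms(1,2)] assms(3) by auto
  then have "fps_nth ?S (subdegree ?S) \<noteq> 0"
    by (rule nth_subdegree_nonzero)
  then have "a (real (subdegree ?S) / real n) \<noteq> b (real (subdegree ?S) / real n)"
    unfolding fps_sub_nth ramify_nth by (simp only: right_minus_eq not_False_eq_True)
  then show ?thesis
    unfolding contact_def diff using ord_y_unramify[OF n \<open>?S \<noteq> 0\<close>] by blast
qed

lemma contact_refl: "contact a a = \<infinity>"
  by (simp add: contact_def ord_y_def top_ereal_def)

lemma contact_gt_iff:
  assumes "denominator n a" "denominator n b"
  shows "contact a b > ereal h \<longleftrightarrow> (\<forall>e\<le>h. a e = b e)"
proof (cases "a = b")
  case False
  then obtain k :: nat where k: "contact a b = ereal (real k / real n)"
    and ne: "a (real k / real n) \<noteq> b (real k / real n)"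
    using contact_attained[OF assms] by blast
  have "\<forall>e<real k / real n. a e = b e"
    using k contact_ge_iff[of "real k / real n" a b] by simp
  then show ?thesis
    unfolding k using ne by (metis ereal_less_eq(3) le_less_trans less_ereal.simps(1) linorder_not_le)
qed (simp add: contact_refl)

lemma is_arc_common_denominator:
  assumes "is_arc a" "denominator n b"
  shows "\<exists>k. denominator k a \<and> denominator k b"
proof -
  obtain m where m: "denominator m a"
    using assms(1) by (auto simp: is_arc_def)
  then show ?thesis
    using denominator_mult[OF m, of n] denominator_mult[OF assms(2), of m] assms(2)
    by (metis denominator_def mult.commute)
qed

section \<open>The tree in terms of discs\<close>

definition common_denominator :: "nat \<Rightarrow> fracseries set \<Rightarrow> bool" where
  "common_denominator N R \<longleftrightarrow> finite R \<and> (\<forall>a\<in>R. denominator N a \<and> a 0 = 0)"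

text \<open>The arcs that are not bounded by \<open>B\<close>; see \<open>bounded_by_iff\<close>.\<close>
definition disc_of :: "bar \<Rightarrow> fracseries set" where
  "disc_of B = {\<xi>. near (bar_arc B) (height B) \<xi>}"

text \<open>The invariant of the bars of the tree: the roots on a bar are exactly the roots in its disc, and its
height is an exponent at the common level.\<close>
definition disc_bar :: "nat \<Rightarrow> fracseries set \<Rightarrow> bar \<Rightarrow> bool" where
  "disc_bar N R B \<longleftrightarrow> fst B \<noteq> {} \<and> fst B = R \<inter> disc_of B \<and> (\<exists>H::nat. height B = real H / real N)"

lemma disc_of_iff:
  assumes "disc_bar N R B" "b \<in> fst B"
  shows "\<xi> \<in> disc_of B \<longleftrightarrow> (\<forall>e<height B. \<xi> e = b e)"
proof -
  have "b \<in> disc_of B"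
    using assms by (auto simp: disc_bar_def)
  then show ?thesis
    by (simp add: disc_of_def near_def)
qed

lemma denominator_bar_arc:
  assumes R: "common_denominator N R" and B: "disc_bar N R B"
  shows "denominator N (bar_arc B)" "bar_arc B 0 = 0" "denominator N (bar_arc_plus B z)"
proof -
  have "(SOME a. a \<in> fst B) \<in> R"
    using B by (metis IntE disc_bar_def some_in_eq)
  then have "denominator N (SOME a. a \<in> fst B)" "(SOME a. a \<in> fst B) 0 = 0"
    using R by (simp_all add: common_denominator_def)
  then show "denominator N (bar_arc B)" "bar_arc B 0 = 0"
    by (auto simp: denominator_def bar_arc_def)
  then show "denominator N (bar_arc_plus B z)"
    using B by (auto simp: disc_bar_def denominator_def bar_arc_plus_def)
qed

lemma bounded_by_iff: "bounded_by \<xi> B \<longleftrightarrow> \<xi> \<notin> disc_of B"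
  using contact_ge_iff[of "height B" \<xi> "bar_arc B"]
  by (auto simp: bounded_by_def disc_of_def near_def)

lemma climbs_iff:
  assumes "common_denominator N R" "disc_bar N R B" "is_arc \<xi>"
  shows "climbs \<xi> B z \<longleftrightarrow> \<xi> \<in> disc_of B \<and> \<xi> (height B) = z"
proof -
  obtain k where "denominator k \<xi>" "denominator k (bar_arc_plus B z)"
    using is_arc_common_denominator[OF assms(3) denominator_bar_arc(3)[OF assms(1,2)]] by blast
  then have "climbs \<xi> B z \<longleftrightarrow> (\<forall>e\<le>height B. \<xi> e = bar_arc_plus B z e)"
    unfolding climbs_def by (rule contact_gt_iff)
  then show ?thesis
    by (auto simp: disc_of_def near_def bar_arc_plus_def bar_arc_def le_less)
qed

definition trunk :: "bar \<Rightarrow> complex \<Rightarrow> fracseries set" where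
  "trunk B z = {b \<in> fst B. b (height B) = z}"

definition growth_points :: "bar \<Rightarrow> complex set" where
  "growth_points B = (\<lambda>a. a (height B)) ` fst B"

lemma trunks_on_eq:
  assumes R: "common_denominator N R" and B: "disc_bar N R B"
  shows "trunks_on B = trunk B ` growth_points B"
proof -
  have "{b \<in> fst B. contact a b > ereal (height B)} = trunk B (a (height B))" if "a \<in> fst B" for a
  proof -
    have "contact a b > ereal (height B) \<longleftrightarrow> b (height B) = a (height B)" if b: "b \<in> fst B" for b
    proof -
      have "denominator N a" "denominator N b"
        using R B b \<open>a \<in> fst B\<close> by (auto simp: disc_bar_def common_denominator_def)
      then have "contact a b > ereal (height B) \<longleftrightarrow> (\<forall>e\<le>height B. a e = b e)"
        by (rule contact_gt_iff)
      moreover have "\<forall>e<height B. a e = b e"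
        using disc_of_iff[OF B b, of a] \<open>a \<in> fst B\<close> B by (auto simp: disc_bar_def)
      ultimately show ?thesis
        by (metis le_less)
    qed
    then show ?thesis
      by (auto simp: trunk_def)
  qed
  then show ?thesis
    by (force simp: trunks_on_def growth_points_def image_image)
qed

lemma growth_point_trunk:
  assumes R: "common_denominator N R" and B: "disc_bar N R B" and z: "z \<in> growth_points B"
  shows "growth_point B (trunk B z) = z"
proof -
  have arc: "is_arc \<xi>" "\<xi> \<in> disc_of B" if "\<xi> \<in> fst B" for \<xi>
    using R B that by (auto simp: is_arc_def disc_bar_def common_denominator_def)
  have "climbs \<xi> B c \<longleftrightarrow> c = z" if "\<xi> \<in> trunk B z" for \<xi> c
    using climbs_iff[OF R B arc(1)] arc(2) that by (auto simp: trunk_def)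
  moreover have "trunk B z \<noteq> {}"
    using z by (auto simp: growth_points_def trunk_def)
  ultimately have "(\<forall>\<xi>\<in>trunk B z. climbs \<xi> B c) \<longleftrightarrow> c = z" for c
    by auto
  then show ?thesis
    by (simp add: growth_point_def)
qed

text \<open>The infimum that defines the height of the bar on top of a trunk runs over finitely many pairs, so it
is the contact order of two roots of the trunk: an exponent at the common level, and larger than \<open>h(B)\<close>
as the two roots agree up to \<open>y\<^bsup>h(B)\<^esup>\<close>.\<close>
lemma top_bar:
  assumes R: "common_denominator N R" and B: "disc_bar N R B" and z: "z \<in> growth_points B"
    and inf: "trunk_height (trunk B z) \<noteq> \<infinity>"
  defines "B' \<equiv> (trunk B z, real_of_ereal (trunk_height (trunk B z)))"
  shows "disc_bar N R B'" "height B < height B'"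
proof -
  let ?T = "trunk B z"
  have TR: "?T \<subseteq> R" and T0: "?T \<noteq> {}"
    using B z by (auto simp: trunk_def disc_bar_def growth_points_def)
  have fin: "finite ?T"
    using R TR finite_subset by (auto simp: common_denominator_def)
  have den: "denominator N a" if "a \<in> ?T" for a
    using R TR that by (auto simp: common_denominator_def)
  define C where "C = (\<lambda>(a, b). contact a b) ` (?T \<times> ?T)"
  have C: "finite C" "C \<noteq> {}"
    using fin T0 by (auto simp: C_def)
  have "trunk_height ?T = Inf C"
    unfolding trunk_height_def
  proof (rule antisym)
    show "(INF a\<in>?T. INF b\<in>?T. contact a b) \<le> Inf C"
      unfolding C_def by (rule INF_greatest) (auto intro: INF_lower INF_lower2)
    show "Inf C \<le> (INF a\<in>?T. INF b\<in>?T. contact a b)"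
      by (intro INF_greatest Inf_lower) (auto simp: C_def)
  qed
  also have "\<dots> = Min C"
    using C by (simp add: Min_Inf)
  finally have height_Min: "trunk_height ?T = Min C" .
  then have "trunk_height ?T \<in> C"
    using C by simp
  then obtain a b where ab: "a \<in> ?T" "b \<in> ?T" "trunk_height ?T = contact a b"
    by (auto simp: C_def)
  then have "a \<noteq> b"
    using inf contact_refl by metis
  then obtain k :: nat where k: "trunk_height ?T = ereal (real k / real N)"
    and ne: "a (real k / real N) \<noteq> b (real k / real N)"
    using contact_attained[OF den[OF ab(1)] den[OF ab(2)]] ab(3) by auto
  then have h': "height B' = real k / real N"
    by (simp add: B'_def height_def)
  have agree: "\<forall>e<height B'. c e = d e" if "c \<in> ?T" "d \<in> ?T" for c d
  proof -
    have "trunk_height ?T \<le> contact c d"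
      unfolding height_Min using C that by (intro Min_le) (auto simp: C_def)
    then show ?thesis
      unfolding k h' by (simp only: contact_ge_iff)
  qed
  have agree_B: "\<forall>e\<le>height B. c e = d e" if "c \<in> ?T" "d \<in> ?T" for c d
  proof -
    have "c \<in> disc_of B" "d \<in> fst B"
      using that B by (auto simp: trunk_def disc_bar_def)
    then show ?thesis
      using disc_of_iff[OF B] that by (auto simp: trunk_def le_less)
  qed
  show less: "height B < height B'"
    using ne agree_B[OF ab(1,2)] unfolding h' by (meson linorder_not_le)
  have some: "(SOME a. a \<in> ?T) \<in> ?T"
    using T0 by (simp add: some_in_eq)
  have "x \<in> ?T \<longleftrightarrow> x \<in> disc_of B'" if "x \<in> R" for x
  proof -
    have disc: "x \<in> disc_of B' \<longleftrightarrow> (\<forall>e<height B'. x e = (SOME a. a \<in> ?T) e)"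
      by (auto simp: disc_of_def near_def bar_arc_def B'_def)
    show ?thesis
    proof
      assume "x \<in> disc_of B'"
      then have *: "\<forall>e\<le>height B. x e = (SOME a. a \<in> ?T) e"
        using disc less by auto
      moreover have "(SOME a. a \<in> ?T) \<in> fst B"
        using some by (simp add: trunk_def)
      ultimately have "x \<in> disc_of B"
        using disc_of_iff[OF B, of _ x] by auto
      then have "x \<in> fst B"
        using that B by (auto simp: disc_bar_def)
      then show "x \<in> ?T"
        using * some by (auto simp: trunk_def)
    qed (use agree some disc in auto)
  qed
  then show "disc_bar N R B'"
    using TR T0 h' unfolding disc_bar_def by (auto simp: B'_def)
qed

lemma disc_bar_bars:
  assumes R: "common_denominator N R" "R \<noteq> {}" and "B \<in> bars R"
  shows "disc_bar N R B"
  using assms(3)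
proof induction
  case ground
  have "a e = 0" if "a \<in> R" "e < 0" for a e
  proof (rule ccontr)
    assume "a e \<noteq> 0"
    moreover have "denominator N a"
      using R(1) that(1) by (simp add: common_denominator_def)
    ultimately obtain k :: nat where "e = real k / real N"
      unfolding denominator_def by blast
    then have "0 \<le> e"
      by simp
    then show False
      using that(2) by simp
  qed
  moreover have "(SOME a. a \<in> R) \<in> R"
    using R(2) by (simp add: some_in_eq)
  ultimately have "a e = (SOME a. a \<in> R) e" if "a \<in> R" "e < 0" for a e
    using that by metis
  then show ?case
    using R(2) by (auto simp: disc_bar_def disc_of_def near_def bar_arc_def height_def intro!: exI[of _ 0])
next
  case (top B T)
  then obtain z where "z \<in> growth_points B" "T = trunk B z"
    using trunks_on_eq[OF R(1) top.IH] by auto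
  then show ?case
    using top_bar(1)[OF R(1) top.IH] top.hyps by simp
qed

lemma postbar_at_disc:
  assumes R: "common_denominator N R" and B: "disc_bar N R B" and "postbar_at B c B'"
  shows "disc_bar N R B'" "height B < height B'" "fst B' \<subseteq> trunk B c"
proof -
  obtain T where T: "T \<in> trunks_on B" "growth_point B T = c" "trunk_height T \<noteq> \<infinity>"
    "B' = (T, real_of_ereal (trunk_height T))"
    using assms(3) by (auto simp: postbar_at_def)
  then obtain z where z: "z \<in> growth_points B" "T = trunk B z"
    using trunks_on_eq[OF R B] by auto
  then have "z = c"
    using growth_point_trunk[OF R B z(1)] T(2) by simp
  then show "disc_bar N R B'" "height B < height B'" "fst B' \<subseteq> trunk B c"
    using top_bar[OF R B z(1)] T(3,4) z by simp_all
qed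

lemma lies_over_disc:
  assumes R: "common_denominator N R" and B: "disc_bar N R B" and "lies_over B c B'"
  shows "disc_bar N R B'" "height B < height B'" "fst B' \<subseteq> trunk B c"
proof -
  obtain B1 where B1: "postbar_at B c B1" "postbar\<^sup>*\<^sup>* B1 B'"
    using assms(3) by (auto simp: lies_over_def)
  from B1(2) have "disc_bar N R B' \<and> height B < height B' \<and> fst B' \<subseteq> trunk B c"
  proof induction
    case base
    then show ?case
      using postbar_at_disc[OF R B B1(1)] by simp
  next
    case (step Y Z)
    then obtain d where "postbar_at Y d Z"
      by (auto simp: postbar_def)
    then show ?case
      using postbar_at_disc[OF R, of Y d Z] step.IH by (auto simp: trunk_def)
  qed
  then show "disc_bar N R B'" "height B < height B'" "fst B' \<subseteq> trunk B c"
    by simp_all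
qed

text \<open>An arc that is not bounded by a bar over \<open>c\<close> agrees up to \<open>y\<^bsup>h(B)\<^esup>\<close> with a root on that bar.\<close>
lemma disc_of_lies_over:
  assumes R: "common_denominator N R" and B: "disc_bar N R B" and "lies_over B c B'"
    and "\<xi> \<in> disc_of B'"
  shows "\<xi> \<in> disc_of B" "\<xi> (height B) = c"
proof -
  note B' = lies_over_disc[OF assms(1-3)]
  obtain r where r: "r \<in> fst B'"
    using B'(1) by (auto simp: disc_bar_def)
  then have "r \<in> fst B" "r (height B) = c"
    using B'(3) by (auto simp: trunk_def)
  moreover have "\<forall>e<height B'. \<xi> e = r e"
    using disc_of_iff[OF B'(1) r] assms(4) by simp
  ultimately show "\<xi> \<in> disc_of B" "\<xi> (height B) = c"
    using disc_of_iff[OF B] B'(2) by auto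
qed

text \<open>Discs are balls of an ultrametric: two that meet are comparable.\<close>
lemma discs_nested:
  assumes "disc_bar N R B1" "disc_bar N R B2" "height B1 \<le> height B2"
    and "\<xi> \<in> disc_of B1" "\<xi> \<in> disc_of B2"
  shows "fst B2 \<subseteq> fst B1"
proof
  fix b assume b: "b \<in> fst B2"
  have "\<forall>e<height B2. \<xi> e = b e"
    using disc_of_iff[OF assms(2) b] assms(5) by simp
  then have "b \<in> disc_of B1"
    using assms(3,4) by (auto simp: disc_of_def near_def)
  then show "b \<in> fst B1"
    using assms(1,2) b by (auto simp: disc_bar_def)
qed

section \<open>Polar roots on a bar\<close>

text \<open>For a number \<open>z\<close> that is not a zero of the lowest coefficient, the specialisation at \<open>z\<close> does not change
the order in \<open>t\<close>.\<close>
lemma nu_eq: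
  assumes F: "puiseux_at N F rs" and R: "common_denominator N R" and B: "disc_bar N R B"
    and h: "height B = real H / real N" "H > 0"
  defines "A \<equiv> disc (ramify N (bar_arc B)) H (ramify2 N F)"
  shows "nu F B = real (subdegree A) / real N"
proof -
  note arc = denominator_bar_arc[OF R B]
  have N: "N > 0"
    using F by (simp add: puiseux_at_def)
  then have pos: "height B > 0"
    using h by simp
  obtain k where "k \<noteq> 0" "lead A = smult k (\<Prod>a\<leftarrow>filter (near (bar_arc B) (height B)) rs. [:- a (height B), 1:])"
    using lead_disc[OF F arc(1,2) _ h] unfolding A_def by (auto simp: bar_arc_def)
  then have lead0: "lead A \<noteq> 0"
    by (simp add: order_prod_linear(3))
  have ramify_plus: "ramify N (bar_arc_plus B z) = ramify N (bar_arc B) + fps_const z * fps_X ^ H" for z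
    by (rule fps_ext) (use N in \<open>auto simp: bar_arc_plus_def h(1) fps_X_power_nth\<close>)
  have ord: "ord_y (eval_arc F (bar_arc_plus B z)) = ereal (real (subdegree A) / real N)"
    if z: "poly (lead A) z \<noteq> 0" for z
  proof -
    have "bar_arc_plus B z 0 = 0"
      using arc(2) pos by (simp add: bar_arc_plus_def)
    then have "eval_arc F (bar_arc_plus B z) = unramify N (at_z z A)"
      using at_z_disc[of "ramify N (bar_arc B)" H z "ramify2 N F"] arc(2) h(2)
      by (simp add: eval_arc_eq[OF arc(3)] ramify_plus A_def)
    moreover have "subdegree (at_z z A) = subdegree A"
      using z by (intro subdegreeI) (simp_all add: at_z_def lead_def nth_less_subdegree_zero)
    moreover have "at_z z A \<noteq> 0"
      using z by (auto simp: at_z_def lead_def fps_eq_iff)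
    ultimately show ?thesis
      using ord_y_unramify[OF N, of "at_z z A"] by simp
  qed
  have fin: "finite {z. poly (lead A) z = 0}"
    using lead0 by (rule poly_roots_finite)
  have generic: "generic B Pr \<longleftrightarrow> finite {z. \<not> Pr z}" for Pr
    using pos by (simp add: generic_def)
  show ?thesis
    unfolding nu_def generic
  proof (rule the_equality)
    show "finite {z. ord_y (eval_arc F (bar_arc_plus B z)) \<noteq> ereal (real (subdegree A) / real N)}"
      by (rule finite_subset[OF _ fin]) (use ord in auto)
    fix v assume "finite {z. ord_y (eval_arc F (bar_arc_plus B z)) \<noteq> ereal v}"
    then have "finite ({z. ord_y (eval_arc F (bar_arc_plus B z)) \<noteq> ereal v} \<union> {z. poly (lead A) z = 0})"
      using fin by simp
    then obtain z where "z \<notin> {z. ord_y (eval_arc F (bar_arc_plus B z)) \<noteq> ereal v} \<union> {z. poly (lead A) z = 0}"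
      using ex_new_if_finite[OF infinite_UNIV_char_0] by blast
    then show "v = real (subdegree A) / real N"
      using ord[of z] by simp
  qed
qed

text \<open>The determinant is multiplied by \<open>N t\<^sup>N\<^sup>-\<^sup>1\<close> under \<open>y = t\<^sup>N\<close>. The factor \<open>N\<close> matches the division of the orders
in \<open>t\<close> by \<open>N\<close>, which turns them into orders in \<open>y\<close>.\<close>
lemma lead_disc_jacobian:
  fixes f g :: series2
  assumes N: "N > 0" and l: "fps_nth l 0 = 0" "H > 0"
  defines "A \<equiv> disc l H (ramify2 N f)" and "C \<equiv> disc l H (ramify2 N g)"
  defines "K \<equiv> smult (of_real (real (subdegree A) / real N)) (lead A * pderiv (lead C)) -
      smult (of_real (real (subdegree C) / real N)) (pderiv (lead A) * lead C)"
  assumes "K \<noteq> 0"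
  shows "lead (disc l H (ramify2 N (jacobian_det f g))) = K"
proof -
  have NK: "of_nat (subdegree A) * (lead A * pderiv (lead C)) -
      of_nat (subdegree C) * (pderiv (lead A) * lead C) = smult (of_nat N) K"
    using N by (simp add: K_def smult_diff_right of_nat_poly)
  have "fps_X * (fps_deriv A * deriv_z C - deriv_z A * fps_deriv C) =
      fps_X * fps_X ^ H * (fps_poly (fps_deriv (fps_X ^ N)) * disc l H (ramify2 N (jacobian_det f g)))"
    unfolding A_def C_def disc_jacobian[OF l] jacobian_ramify2[OF N] disc_mult[OF l] disc_const
    by (simp only: mult.assoc)
  moreover have "lead (fps_X * (fps_deriv A * deriv_z C - deriv_z A * fps_deriv C)) = smult (of_nat N) K"
    using lead_wronskian[of A C] \<open>K \<noteq> 0\<close> N unfolding NK by simp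
  moreover have "lead (fps_poly (fps_deriv (fps_X ^ N))) = [:of_nat N:]"
    using leadI(1)[of "N - 1" "fps_poly (fps_deriv (fps_X ^ N))"] N
    by (simp add: fps_deriv_power' fps_X_power_nth fps_mult_left_const_nth flip: fps_of_nat)
  moreover have "lead (fps_X ^ k) = 1" for k
    using leadI(1)[of k "fps_X ^ k"] by (simp add: fps_X_power_nth)
  from this[of H] this[of 1] have "lead (fps_X ^ H) = 1" "lead fps_X = 1"
    by simp_all
  ultimately have "smult (of_nat N) (lead (disc l H (ramify2 N (jacobian_det f g)))) = smult (of_nat N) K"
    by (simp add: lead_mult)
  then show ?thesis
    using N by (metis of_nat_eq_0_iff less_numeral_extra(3) smult_cancel)
qed

lemma sum_list_group:
  fixes \<phi> :: "complex \<Rightarrow> complex"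
  assumes "distinct as" "finite V" "r ` set as \<subseteq> V"
  shows "(\<Sum>a\<leftarrow>as. \<phi> (r a)) = (\<Sum>v\<in>V. of_nat (card {a \<in> set as. r a = v}) * \<phi> v)"
proof -
  have "(\<Sum>a\<leftarrow>as. \<phi> (r a)) = (\<Sum>a\<in>set as. \<phi> (r a))"
    using assms(1) by (simp add: sum_list_distinct_conv_sum_set)
  also have "\<dots> = (\<Sum>v\<in>V. \<Sum>a\<in>{a \<in> set as. r a = v}. \<phi> (r a))"
    by (rule sum.group[symmetric]) (use assms in auto)
  also have "\<dots> = (\<Sum>v\<in>V. of_nat (card {a \<in> set as. r a = v}) * \<phi> v)"
    by simp
  finally show ?thesis .
qed

text \<open>By \<open>log_derivative\<close> the rational function of the bar is \<open>\<mu> G'/G - \<kappa> F'/F = K / (F G)\<close>, so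
that the zeros of \<open>K\<close>, which is the lowest coefficient of the Jacobian determinant, are counted by
\<open>wronskian_zero_count\<close>. Since \<open>P\<close> and \<open>Q\<close> are disjoint and their members are simple roots, degrees
and orders of \<open>F\<close> and \<open>G\<close> are cardinalities.\<close>
lemma polar_roots_on_bar:
  fixes f g :: series2
  assumes f: "puiseux_at N f as" and g: "puiseux_at N g bs" and dist: "distinct (as @ bs)"
    and P: "P = set as" and Q: "Q = set bs"
    and B: "disc_bar N (P \<union> Q) B" and pos: "height B > 0"
    and noncol: "\<not> collinear_bar f g P Q B"
  shows "jacobian_det f g \<noteq> 0"
    and "puiseux_at N (jacobian_det f g) cs \<Longrightarrow>
      length (filter (\<lambda>\<gamma>. \<gamma> \<in> disc_of B) cs) + card (noncollinear_points f g P Q B) =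
      card (fst B) + total_zero_mult f g P Q B"
    and "puiseux_at N (jacobian_det f g) cs \<Longrightarrow> c \<in> collinear_points f g P Q B \<Longrightarrow>
      length (filter (\<lambda>\<gamma>. \<gamma> \<in> disc_of B \<and> \<gamma> (height B) = c) cs) =
      card (trunk B c) + zero_mult f g P Q B c"
proof -
  have N: "N > 0"
    using f by (simp add: puiseux_at_def)
  have R: "common_denominator N (P \<union> Q)"
    using f g by (auto simp: common_denominator_def puiseux_at_def P Q)
  obtain H where h: "height B = real H / real N"
    using B by (auto simp: disc_bar_def)
  have H: "H > 0"
    using pos h by (auto intro: Nat.gr0I)
  note arc = denominator_bar_arc[OF R B]
  have arc_high: "bar_arc B e = 0" if "height B \<le> e" for e
    using that by (simp add: bar_arc_def)
  have l: "fps_nth (ramify N (bar_arc B)) 0 = 0"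
    by (simp add: arc)
  let ?h = "height B" and ?D = "\<lambda>F. disc (ramify N (bar_arc B)) H (ramify2 N F)"
  have near: "near (bar_arc B) ?h = (\<lambda>\<xi>. \<xi> \<in> disc_of B)"
    by (simp add: disc_of_def)
  define as' bs' where "as' = filter (\<lambda>\<xi>. \<xi> \<in> disc_of B) as" and "bs' = filter (\<lambda>\<xi>. \<xi> \<in> disc_of B) bs"
  have set': "set as' = fst B \<inter> P" "set bs' = fst B \<inter> Q" and dist': "distinct as'" "distinct bs'"
    using B dist by (auto simp: as'_def bs'_def disc_bar_def P Q)
  define F G where "F = lead (?D f)" and "G = lead (?D g)"
  obtain kf where kf: "kf \<noteq> 0" "F = smult kf (\<Prod>a\<leftarrow>as'. [:- a ?h, 1:])"
    using lead_disc[OF f arc(1,2) arc_high h H] unfolding F_def as'_def near by blast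
  obtain kg where kg: "kg \<noteq> 0" "G = smult kg (\<Prod>a\<leftarrow>bs'. [:- a ?h, 1:])"
    using lead_disc[OF g arc(1,2) arc_high h H] unfolding G_def bs'_def near by blast
  have FG: "F \<noteq> 0" "G \<noteq> 0"
    using kf kg by (simp_all add: order_prod_linear(3))
  have filter_card: "length (filter (\<lambda>a. a ?h = z) xs) = card (trunk B z \<inter> S)"
    if "set xs = fst B \<inter> S" "distinct xs" for xs z and S :: "fracseries set"
  proof -
    have "set (filter (\<lambda>a. a ?h = z) xs) = trunk B z \<inter> S"
      using that(1) by (auto simp: trunk_def)
    then show ?thesis
      using that(2) by (metis distinct_card distinct_filter)
  qed
  have order_F: "order z F = card (trunk B z \<inter> P)" and order_G: "order z G = card (trunk B z \<inter> Q)" for z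
    using kf kg filter_card[OF set'(1) dist'(1)] filter_card[OF set'(2) dist'(2)]
    by (simp_all add: order_smult order_prod_linear(1))
  define \<mu> \<kappa> where "\<mu> = complex_of_real (nu f B)" and "\<kappa> = complex_of_real (nu g B)"
  define K where "K = smult \<mu> (F * pderiv G) - smult \<kappa> (pderiv F * G)"
  define \<Delta> where "\<Delta> = (\<lambda>z. \<mu> * of_nat (order z G) - \<kappa> * of_nat (order z F))"
  have \<Delta>: "\<Delta> z = complex_of_real (Delta f g P Q B (trunk B z))" for z
    by (simp add: \<Delta>_def \<mu>_def \<kappa>_def Delta_def order_F order_G)
  let ?V = "growth_points B"
  have finB: "finite (fst B)"
    using R B by (auto simp: common_denominator_def disc_bar_def)
  then have finV: "finite ?V"
    by (simp add: growth_points_def)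
  have trunks: "trunks_on B = trunk B ` ?V"
    by (rule trunks_on_eq[OF R B])
  have growth: "growth_point B (trunk B v) = v" if "v \<in> ?V" for v
    by (rule growth_point_trunk[OF R B that])
  have "trunk B z = {}" if "z \<notin> ?V" for z
    using that by (auto simp: growth_points_def trunk_def)
  then have \<Delta>_out: "\<Delta> z = 0" if "z \<notin> ?V" for z
    using that by (simp add: \<Delta> Delta_def)
  have noncollinear: "noncollinear_points f g P Q B = {z. \<Delta> z \<noteq> 0}"
  proof -
    have "noncollinear_points f g P Q B = {v \<in> ?V. \<Delta> v \<noteq> 0}"
    proof -
      have "{T \<in> trunks_on B. Delta f g P Q B T \<noteq> 0} = trunk B ` {v \<in> ?V. \<Delta> v \<noteq> 0}"
        by (auto simp: trunks \<Delta>)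
      moreover have "growth_point B ` trunk B ` {v \<in> ?V. \<Delta> v \<noteq> 0} = (\<lambda>v. v) ` {v \<in> ?V. \<Delta> v \<noteq> 0}"
        unfolding image_image by (rule image_cong) (auto simp: growth)
      ultimately show ?thesis
        by (simp add: noncollinear_points_def)
    qed
    then show ?thesis
      using \<Delta>_out by auto
  qed
  then obtain z0 where "\<Delta> z0 \<noteq> 0"
    using noncol by (auto simp: collinear_bar_def)
  then have K: "K \<noteq> 0"
    using order_wronskian(1)[OF FG, where \<mu> = \<mu> and \<kappa> = \<kappa> and z = z0] by (simp add: K_def \<Delta>_def)
  have lead_J: "lead (?D (jacobian_det f g)) = K"
    using lead_disc_jacobian[OF N l H, of f g] K nu_eq[OF f R B h H] nu_eq[OF g R B h H]
    by (simp add: K_def \<mu>_def \<kappa>_def F_def G_def)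
  show "jacobian_det f g \<noteq> 0"
  proof
    assume "jacobian_det f g = 0"
    then have "lead (?D (jacobian_det f g)) = 0"
      using N ramify2_const[of N 0] disc_diff[of "ramify N (bar_arc B)" H 0 0] by (simp add: lead_def)
    then show False
      using lead_J K by simp
  qed
  have M: "rational_fun f g P Q B z = poly K z / poly (F * G) z" if "poly F z \<noteq> 0" "poly G z \<noteq> 0" for z
  proof -
    have "inj_on (trunk B) ?V"
      by (rule inj_onI) (metis growth)
    then have "rational_fun f g P Q B z = (\<Sum>v\<in>?V. \<Delta> v / (z - v))"
      unfolding rational_fun_def trunks by (subst sum.reindex) (auto simp: \<Delta> growth intro!: sum.cong)
    also have "\<dots> = \<mu> * (\<Sum>v\<in>?V. of_nat (order v G) * (1 / (z - v))) -
        \<kappa> * (\<Sum>v\<in>?V. of_nat (order v F) * (1 / (z - v)))"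
      by (simp add: \<Delta>_def sum_distrib_left sum_subtractf[symmetric] diff_divide_distrib)
    also have "(\<Sum>v\<in>?V. of_nat (order v G) * (1 / (z - v))) = (\<Sum>b\<leftarrow>bs'. 1 / (z - b ?h))"
    proof -
      have "order v G = card {a \<in> set bs'. a ?h = v}" for v
        unfolding order_G set' by (rule arg_cong[where f = card]) (auto simp: trunk_def)
      moreover have "(\<lambda>a. a ?h) ` set bs' \<subseteq> ?V"
        using set' by (auto simp: growth_points_def)
      ultimately show ?thesis
        using sum_list_group[OF dist'(2) finV, where r = "\<lambda>a. a ?h" and \<phi> = "\<lambda>v. 1 / (z - v)"]
        by (simp only: simp_thms)
    qed
    also have "(\<Sum>v\<in>?V. of_nat (order v F) * (1 / (z - v))) = (\<Sum>b\<leftarrow>as'. 1 / (z - b ?h))"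
    proof -
      have "order v F = card {a \<in> set as'. a ?h = v}" for v
        unfolding order_F set' by (rule arg_cong[where f = card]) (auto simp: trunk_def)
      moreover have "(\<lambda>a. a ?h) ` set as' \<subseteq> ?V"
        using set' by (auto simp: growth_points_def)
      ultimately show ?thesis
        using sum_list_group[OF dist'(1) finV, where r = "\<lambda>a. a ?h" and \<phi> = "\<lambda>v. 1 / (z - v)"]
        by (simp only: simp_thms)
    qed
    also have "(\<Sum>b\<leftarrow>bs'. 1 / (z - b ?h)) = poly (pderiv G) z / poly G z"
      by (rule log_derivative[OF kg(2,1) that(2), symmetric])
    also have "(\<Sum>b\<leftarrow>as'. 1 / (z - b ?h)) = poly (pderiv F) z / poly F z"
      by (rule log_derivative[OF kf(2,1) that(1), symmetric])
    also have "\<mu> * (poly (pderiv G) z / poly G z) - \<kappa> * (poly (pderiv F) z / poly F z) =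
        poly K z / poly (F * G) z"
      using that by (simp add: K_def field_simps)
    finally show ?thesis .
  qed
  note count = wronskian_zero_count[OF FG, where \<mu> = \<mu> and \<kappa> = \<kappa>, folded K_def, OF K M]
  have "degree F + degree G = card (fst B)"
  proof -
    have "fst B = set as' \<union> set bs'" "set as' \<inter> set bs' = {}"
      using set' B dist by (auto simp: disc_bar_def P Q)
    then have "card (fst B) = length as' + length bs'"
      using dist' by (simp add: card_Un_disjoint distinct_card)
    then show ?thesis
      using kf kg by (simp add: order_prod_linear(2))
  qed
  then have deg: "degree K + card (noncollinear_points f g P Q B) = card (fst B) + total_zero_mult f g P Q B"
    using count(2) unfolding noncollinear by (simp add: total_zero_mult_def zero_mult_def \<Delta>_def)
  have ord: "order c K = card (trunk B c) + zero_mult f g P Q B c" if "c \<in> collinear_points f g P Q B"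
  proof -
    have "\<Delta> c = 0"
      using that by (auto simp: collinear_points_def trunks growth \<Delta>)
    then have "order c K = card (trunk B c \<inter> P) + card (trunk B c \<inter> Q) + zero_mult f g P Q B c"
      using count(1)[of c] by (simp add: zero_mult_def \<Delta>_def order_F order_G)
    moreover have "card (trunk B c) = card (trunk B c \<inter> P) + card (trunk B c \<inter> Q)"
    proof -
      have "trunk B c = (trunk B c \<inter> P) \<union> (trunk B c \<inter> Q)" "(trunk B c \<inter> P) \<inter> (trunk B c \<inter> Q) = {}"
        using B dist by (auto simp: trunk_def disc_bar_def P Q)
      then show ?thesis
        by (metis P Q List.finite_set card_Un_disjoint finite_Int)
    qed
    ultimately show ?thesis
      by simp
  qed
  assume J: "puiseux_at N (jacobian_det f g) cs"
  obtain k where k: "k \<noteq> 0" "K = smult k (\<Prod>a\<leftarrow>filter (\<lambda>\<xi>. \<xi> \<in> disc_of B) cs. [:- a ?h, 1:])"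
    using lead_disc[OF J arc(1,2) arc_high h H] unfolding lead_J near by blast
  show "length (filter (\<lambda>\<gamma>. \<gamma> \<in> disc_of B) cs) + card (noncollinear_points f g P Q B) =
      card (fst B) + total_zero_mult f g P Q B"
    using deg k by (simp add: order_prod_linear(2))
  show "length (filter (\<lambda>\<gamma>. \<gamma> \<in> disc_of B \<and> \<gamma> ?h = c) cs) = card (trunk B c) + zero_mult f g P Q B c"
    if "c \<in> collinear_points f g P Q B"
    using ord[OF that] k by (simp add: order_smult order_prod_linear(1) conj_commute)
qed

section \<open>Polar roots over a collinear point\<close>

lemma count_list_distinct: "distinct xs \<Longrightarrow> x \<in> set xs \<Longrightarrow> count_list xs x = 1"
  by (induction xs) (auto simp: count_list_0_iff)

lemma length_filter_disjoint:
  assumes "finite S" and sub: "\<And>s x. s \<in> S \<Longrightarrow> D s x \<Longrightarrow> A x"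
    and disj: "\<And>s t x. s \<in> S \<Longrightarrow> t \<in> S \<Longrightarrow> D s x \<Longrightarrow> D t x \<Longrightarrow> s = t"
  shows "length (filter A xs) =
    length (filter (\<lambda>x. A x \<and> (\<forall>s\<in>S. \<not> D s x)) xs) + (\<Sum>s\<in>S. length (filter (D s) xs))"
proof (induction xs)
  case (Cons x xs)
  have step: "(\<Sum>s\<in>S. length (filter (D s) (x # xs))) =
      (\<Sum>s\<in>S. if D s x then 1 else 0) + (\<Sum>s\<in>S. length (filter (D s) xs))"
    unfolding sum.distrib[symmetric] by (rule sum.cong) auto
  show ?case
  proof (cases "\<exists>s\<in>S. D s x")
    case True
    then obtain t where t: "t \<in> S" "D t x"
      by blast
    have "D s x \<longleftrightarrow> s = t" if "s \<in> S" for s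
      using disj[OF that t(1) _ t(2)] t(2) by blast
    then have "(\<Sum>s\<in>S. if D s x then 1 else 0) = (\<Sum>s\<in>S. if s = t then 1 else (0::nat))"
      by (intro sum.cong refl) simp
    then have "(\<Sum>s\<in>S. if D s x then 1 else 0) = (1::nat)"
      using assms(1) t(1) by simp
    moreover have "A x" "\<not> (\<forall>s\<in>S. \<not> D s x)"
      using sub t by blast+
    ultimately show ?thesis
      using Cons unfolding step by simp
  next
    case False
    then have "(\<Sum>s\<in>S. if D s x then 1 else 0) = (0::nat)"
      by (intro sum.neutral) simp
    then show ?thesis
      using Cons False unfolding step by simp
  qed
qed simp

theorem theoremC:
  fixes f g u u' :: series2
    and E1 E2 :: nat
    and \<alpha>s \<beta>s :: "fracseries list"
    and P Q :: "fracseries set"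
    and B :: bar and c :: complex and S :: "bar set"
    and \<Gamma> :: "fracseries set"
  assumes "holomorphic_germ f" and "coeff2 f 0 0 = 0"
    and "holomorphic_germ g" and "coeff2 g 0 0 = 0"
    and "newton_puiseux f u E1 \<alpha>s"
    and "newton_puiseux g u' E2 \<beta>s"
    and "length \<alpha>s + length \<beta>s \<ge> 1"
    and "distinct (\<alpha>s @ \<beta>s)"
    and "P = set \<alpha>s" and "Q = set \<beta>s"
    and "B \<in> bars (P \<union> Q)"
    and "\<not> collinear_bar f g P Q B"
    and "c \<in> collinear_points f g P Q B"
    and "is_cover f g P Q B c S"
    and "\<Gamma> = {\<gamma>. polar_root f g \<gamma> \<and> climbs \<gamma> B c \<and> (\<forall>B'\<in>S. bounded_by \<gamma> B')}"
  shows "finite \<Gamma> \<and>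
    int (\<Sum>\<gamma>\<in>\<Gamma>. root_mult (jacobian_det f g) \<gamma>) =
      int (zero_mult f g P Q B c) +
      (\<Sum>B'\<in>S. int (card (noncollinear_points f g P Q B')) - int (total_zero_mult f g P Q B'))"
proof -
  let ?R = "P \<union> Q" and ?J = "jacobian_det f g"
  have f0: "coeff2 f 0 0 = 0" and g0: "coeff2 g 0 0 = 0"
    and P: "P = set \<alpha>s" and Q: "Q = set \<beta>s" and dist: "distinct (\<alpha>s @ \<beta>s)"
    and noncol: "\<not> collinear_bar f g P Q B" and c: "c \<in> collinear_points f g P Q B"
    and cover: "is_cover f g P Q B c S"
    by (fact assms)+
  obtain nf ng where nf: "puiseux_at nf f \<alpha>s" and ng: "puiseux_at ng g \<beta>s"
    using puiseux_at_newton_puiseux assms(5,6) by blast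
  have level: "puiseux_at (nf * ng * k) f \<alpha>s \<and> puiseux_at (nf * ng * k) g \<beta>s" if "k > 0" for k
  proof -
    have "nf > 0" "ng > 0"
      using nf ng by (simp_all add: puiseux_at_def)
    then show ?thesis
      using puiseux_at_mult[OF nf, of "ng * k"] puiseux_at_mult[OF ng, of "nf * k"] that
      by (simp add: mult_ac)
  qed
  have tree: "common_denominator N ?R \<and> disc_bar N ?R B"
    if "puiseux_at N f \<alpha>s" "puiseux_at N g \<beta>s" for N
  proof -
    have "common_denominator N ?R"
      using that by (auto simp: common_denominator_def puiseux_at_def P Q)
    moreover have "?R \<noteq> {}"
      using assms(7) by (auto simp: P Q)
    ultimately show ?thesis
      using disc_bar_bars[OF _ _ assms(11)] by blast
  qed
  \<comment> \<open>Only the ground bar has height zero. It carries a single trunk, so it cannot be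
    non-collinear and have a collinear point.\<close>
  have pos: "height B > 0"
  proof (rule ccontr)
    assume "\<not> height B > 0"
    moreover note R1 = tree[of "nf * ng * 1"] level[of 1]
    ultimately have "height B = 0"
      by (auto simp: disc_bar_def)
    moreover have R: "common_denominator (nf * ng) ?R" and B: "disc_bar (nf * ng) ?R B"
      using R1 by auto
    ultimately have "growth_points B \<subseteq> {0}"
      by (auto simp: growth_points_def disc_bar_def common_denominator_def)
    then have "trunks_on B \<subseteq> {trunk B 0}"
      using trunks_on_eq[OF R B] by auto
    then show False
      using c noncol by (auto simp: collinear_points_def collinear_bar_def noncollinear_points_def)
  qed
  have "?J \<noteq> 0"
  proof (rule polar_roots_on_bar(1)[OF _ _ dist P Q _ pos noncol])
    show "puiseux_at (nf * ng) f \<alpha>s" "puiseux_at (nf * ng) g \<beta>s"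
      using level[of 1] by simp_all
    then show "disc_bar (nf * ng) ?R B"
      using tree by blast
  qed
  then obtain nJ \<gamma>s where nJ: "puiseux_at nJ ?J \<gamma>s"
    using puiseux_at_exists by blast
  \<comment> \<open>A common denominator of the roots of f, g and J.\<close>
  define N where "N = nf * ng * nJ"
  have "nJ > 0" "nf > 0" "ng > 0"
    using nf ng nJ by (simp_all add: puiseux_at_def)
  then have f: "puiseux_at N f \<alpha>s" and g: "puiseux_at N g \<beta>s" and J: "puiseux_at N ?J \<gamma>s"
    using level[of nJ] puiseux_at_mult[OF nJ, of "nf * ng"] by (simp_all add: N_def mult_ac)
  have R: "common_denominator N ?R" and B: "disc_bar N ?R B"
    using tree[OF f g] by simp_all
  have \<gamma>_arc: "is_arc \<gamma>" "\<gamma> 0 = 0" "denominator N \<gamma>" if "\<gamma> \<in> set \<gamma>s" for \<gamma>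
    using J that by (auto simp: puiseux_at_def is_arc_def)
  have J': "jacobian_det g f = - ?J"
    by (simp add: jacobian_det_def mult.commute)
  have polar: "polar_root f g \<gamma> \<longleftrightarrow> \<gamma> \<in> set \<gamma>s" for \<gamma>
  proof
    assume "polar_root f g \<gamma>"
    then show "\<gamma> \<in> set \<gamma>s"
      using eval_arc_eq_0_iff[OF J] ord_y_pos_imp by (auto simp: polar_root_def)
  next
    assume \<gamma>: "\<gamma> \<in> set \<gamma>s"
    note arc = \<gamma>_arc[OF \<gamma>]
    have JN: "eval_x (ramify N \<gamma>) (ramify2 N ?J) = 0"
      using puiseux_at_root_iff[OF J arc(3,2)] \<gamma> by simp
    have "\<gamma> \<notin> set \<alpha>s"
    proof
      assume a: "\<gamma> \<in> set \<alpha>s"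
      then have "\<gamma> \<notin> set \<beta>s" "count_list \<alpha>s \<gamma> = 1"
        using dist by (auto simp: count_list_distinct)
      then show False
        using jacobian_nonzero_at_root[OF f g g0 a] JN by simp
    qed
    moreover have "\<gamma> \<notin> set \<beta>s"
    proof
      assume a: "\<gamma> \<in> set \<beta>s"
      then have "\<gamma> \<notin> set \<alpha>s" "count_list \<beta>s \<gamma> = 1"
        using dist by (auto simp: count_list_distinct)
      moreover have "ramify2 N (- ?J) = - ramify2 N ?J"
        using ramify2_diff[of N 0 ?J] ramify2_const[of N 0] by simp
      ultimately show False
        using jacobian_nonzero_at_root[OF g f f0 a] JN by (simp add: J' eval_x_minus)
    qed
    ultimately show "polar_root f g \<gamma>"
      using \<gamma> arc ord_y_pos[OF arc(3,2)] eval_arc_eq_0_iff[OF f arc(1,2)] eval_arc_eq_0_iff[OF g arc(1,2)]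
        eval_arc_eq_0_iff[OF J arc(1,2)] by (simp add: polar_root_def)
  qed
  have S: "lies_over B c B'" "\<not> collinear_bar f g P Q B'" "disc_bar N ?R B'" "height B' > 0"
    "fst B' \<subseteq> trunk B c" if "B' \<in> S" for B'
    using cover that lies_over_disc[OF R B, of c B'] pos by (auto simp: is_cover_def)
  have climbs_B: "climbs \<xi> B c \<longleftrightarrow> \<xi> \<in> disc_of B \<and> \<xi> (height B) = c" if "is_arc \<xi>" for \<xi>
    using climbs_iff[OF R B that] .
  have root_arc: "is_arc \<xi>" if "\<xi> \<in> ?R" for \<xi>
    using R that by (auto simp: common_denominator_def is_arc_def)
  \<comment> \<open>A root climbs over B' at some point iff it lies on B'.\<close>
  have covered: "\<exists>!B'. B' \<in> S \<and> \<xi> \<in> fst B'" if "\<xi> \<in> trunk B c" for \<xi>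
  proof -
    have \<xi>: "\<xi> \<in> ?R" "climbs \<xi> B c"
      using that B climbs_B[OF root_arc] by (auto simp: trunk_def disc_bar_def)
    have "(\<exists>a. climbs \<xi> B' a) \<longleftrightarrow> \<xi> \<in> fst B'" if "B' \<in> S" for B'
      using climbs_iff[OF R S(3)[OF that] root_arc[OF \<xi>(1)]] S(3)[OF that] \<xi>(1)
      by (auto simp: disc_bar_def)
    moreover have "\<exists>!B'. B' \<in> S \<and> (\<exists>a. climbs \<xi> B' a)"
      using cover \<xi> by (auto simp: is_cover_def)
    ultimately show ?thesis
      by (metis (no_types, lifting))
  qed
  \<comment> \<open>If two discs meet, the roots in the smaller one lie in both; such a root climbs over both bars.\<close>
  have unique: "B1 = B2" if "B1 \<in> S" "B2 \<in> S" "\<xi> \<in> disc_of B1" "\<xi> \<in> disc_of B2" for B1 B2 \<xi>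
  proof -
    have "fst B1 \<inter> fst B2 \<noteq> {}"
      using discs_nested[OF S(3)[OF that(1)] S(3)[OF that(2)] _ that(3,4)]
        discs_nested[OF S(3)[OF that(2)] S(3)[OF that(1)] _ that(4,3)] S(3)[OF that(1)] S(3)[OF that(2)]
      by (metis disc_bar_def inf.absorb_iff1 inf.absorb_iff2 linorder_linear)
    then obtain \<xi>' where "\<xi>' \<in> fst B1" "\<xi>' \<in> fst B2"
      by blast
    then show ?thesis
      using covered[of \<xi>'] S(5)[OF that(1)] that(1,2) by blast
  qed
  have finT: "finite (trunk B c)"
    using R B by (auto simp: common_denominator_def disc_bar_def trunk_def)
  \<comment> \<open>The bars of the cover carry disjoint nonempty subsets of a finite set.\<close>
  have finS: "finite S"
  proof (rule finite_imageD)
    show "finite (fst ` S)"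
      by (rule finite_subset[of _ "Pow (trunk B c)"]) (use S(5) finT in auto)
    show "inj_on fst S"
    proof (rule inj_onI)
      fix B1 B2 assume *: "B1 \<in> S" "B2 \<in> S" "fst B1 = fst B2"
      then obtain \<xi> where "\<xi> \<in> fst B1"
        using S(3)[OF *(1)] by (auto simp: disc_bar_def)
      then show "B1 = B2"
        using covered[of \<xi>] S(5)[OF *(1)] * by auto
    qed
  qed
  have card_trunk: "card (trunk B c) = (\<Sum>B'\<in>S. card (fst B'))"
  proof -
    have "trunk B c = (\<Union>B'\<in>S. fst B')"
      using covered S(5) by blast
    moreover have "card (\<Union>B'\<in>S. fst B') = (\<Sum>B'\<in>S. card (fst B'))"
    proof (rule card_UN_disjoint[OF finS])
      show "\<forall>B'\<in>S. finite (fst B')"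
        using S(5) finT finite_subset by blast
      show "\<forall>B1\<in>S. \<forall>B2\<in>S. B1 \<noteq> B2 \<longrightarrow> fst B1 \<inter> fst B2 = {}"
        using covered S(5) by blast
    qed
    ultimately show ?thesis
      by simp
  qed
  let ?climb = "\<lambda>\<gamma>. \<gamma> \<in> disc_of B \<and> \<gamma> (height B) = c"
  let ?count = "\<lambda>A. length (filter A \<gamma>s)"
  have \<Gamma>: "\<Gamma> = {\<gamma> \<in> set \<gamma>s. ?climb \<gamma> \<and> (\<forall>B'\<in>S. \<gamma> \<notin> disc_of B')}"
    using climbs_B \<gamma>_arc(1) unfolding assms(15) by (auto simp: polar bounded_by_iff)
  have "(\<Sum>\<gamma>\<in>\<Gamma>. root_mult ?J \<gamma>) = (\<Sum>\<gamma>\<in>\<Gamma>. count_list \<gamma>s \<gamma>)"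
    using \<gamma>_arc by (intro sum.cong refl root_mult_eq_count[OF J]) (auto simp: \<Gamma>)
  also have "\<dots> = ?count (\<lambda>\<gamma>. ?climb \<gamma> \<and> (\<forall>B'\<in>S. \<gamma> \<notin> disc_of B'))"
  proof -
    have "length (filter A xs) = (\<Sum>x\<in>{x \<in> set xs. A x}. count_list xs x)" for A and xs :: "fracseries list"
    proof -
      have "length (filter A xs) = (\<Sum>x\<in>set (filter A xs). count_list (filter A xs) x)"
        by (simp add: sum_count_set)
      also have "\<dots> = (\<Sum>x\<in>{x \<in> set xs. A x}. count_list xs x)"
      proof (rule sum.cong)
        fix x assume "x \<in> {x \<in> set xs. A x}"
        then have "A x" by simp
        then show "count_list (filter A xs) x = count_list xs x"
          by (induction xs) auto
      qed auto
      finally show ?thesis .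
    qed
    then show ?thesis
      by (simp add: \<Gamma>)
  qed
  finally have sum_\<Gamma>: "(\<Sum>\<gamma>\<in>\<Gamma>. root_mult ?J \<gamma>) = ?count (\<lambda>\<gamma>. ?climb \<gamma> \<and> (\<forall>B'\<in>S. \<gamma> \<notin> disc_of B'))" .
  have split: "?count ?climb = ?count (\<lambda>\<gamma>. ?climb \<gamma> \<and> (\<forall>B'\<in>S. \<gamma> \<notin> disc_of B')) +
      (\<Sum>B'\<in>S. ?count (\<lambda>\<gamma>. \<gamma> \<in> disc_of B'))"
  proof (rule length_filter_disjoint[OF finS])
    show "?climb \<gamma>" if "B' \<in> S" "\<gamma> \<in> disc_of B'" for B' \<gamma>
      using disc_of_lies_over[OF R B S(1)[OF that(1)] that(2)] by simp
  qed (rule unique)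
  have "?count ?climb = card (trunk B c) + zero_mult f g P Q B c"
    by (rule polar_roots_on_bar(3)[OF f g dist P Q B pos noncol J c])
  moreover have "int (?count (\<lambda>\<gamma>. \<gamma> \<in> disc_of B')) = int (card (fst B')) -
      (int (card (noncollinear_points f g P Q B')) - int (total_zero_mult f g P Q B'))" if "B' \<in> S" for B'
    using polar_roots_on_bar(2)[OF f g dist P Q S(3)[OF that] S(4)[OF that] S(2)[OF that] J] by linarith
  then have "int (\<Sum>B'\<in>S. ?count (\<lambda>\<gamma>. \<gamma> \<in> disc_of B')) = int (card (trunk B c)) -
      (\<Sum>B'\<in>S. int (card (noncollinear_points f g P Q B')) - int (total_zero_mult f g P Q B'))"
    by (simp add: card_trunk sum_subtractf)
  ultimately have "int (\<Sum>\<gamma>\<in>\<Gamma>. root_mult ?J \<gamma>) = int (zero_mult f g P Q B c) +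
      (\<Sum>B'\<in>S. int (card (noncollinear_points f g P Q B')) - int (total_zero_mult f g P Q B'))"
    using split unfolding sum_\<Gamma> by linarith
  moreover have "finite \<Gamma>"
    by (simp add: \<Gamma>)
  ultimately show ?thesis
    by blast
qed

end
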